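(* Let $d$ be a positive integer and let $\psi\colon[0,\infty)\to\mathbb{R}\cup\{+\infty\}$ be an admissible function satisfying at least one of the following conditions: (1) $\psi$ is strictly increasing and takes only finite values; (2) the effective domain $\{t\in[0,\infty): \psi(t)<+\infty\}$ of $\psi$ is bounded. Let $f\colon\mathbb{R}^d\to[0,\infty)$ be an upper semi-continuous log-concave function of finite positive integral. If there exists $\ell\in\mathcal{E}^d[\psi]$ such that $f\le\ell$, then there exists a unique solution to the problem $$\min_{\ell\in\mathcal{E}^d[\psi]}\int_{\mathbb{R}^d}\ell\quad\text{subject to}\quad f\le\ell.$$ Moreover, the supremum of a solution to this problem is at most $e^d$ times the supremum of $f$.
   Context: $|\cdot|$ denotes the Euclidean norm (absolute value on $\mathbb{R}$), and $e^{-\infty}=0$. A function $f\colon\mathbb{R}^d\to[0,\infty)$ is log-concave if $f=e^{-\varphi}$ for a convex function $\varphi\colon\mathbb{R}^d\to\mathbb{R}\cup\{+\infty\}$. The relation $f_1\le f_2$ means $f_1(x)\le f_2(x)$ for all $x\in\mathbb{R}^d$. A function $\psi\colon[0,\infty)\to\mathbb{R}\cup\{+\infty\}$ is called admissible if $t\mapsto e^{-\psi(|t|)}$, $t\in\mathbb{R}$, is an upper semi-continuous log-concave function of finite positive integral. For such $\psi$, $\mathcal{E}^d[\psi]$ is the class of functions on $\mathbb{R}^d$ of the form $x\mapsto\alpha e^{-\psi(|A(x-a)|)}$ with $A\in\mathrm{GL}(d)$, $\alpha>0$, $a\in\mathbb{R}^d$. Uniqueness of the solution means uniqueness as a function. 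*)

theory Defs
  imports "HOL-Analysis.Analysis"
begin

text \<open>The function \<open>x \<mapsto> e\<^sup>-\<^sup>x\<close> on \<open>\<real> \<union> {+\<infinity>}\<close>, with \<open>e\<^sup>-\<^sup>\<infinity> = 0\<close>. The value at \<open>-\<infinity>\<close> is a
  dummy: the functions below are required not to take the value \<open>-\<infinity>\<close>.\<close>

function exp_neg :: "ereal \<Rightarrow> real" where
  "exp_neg (ereal r) = exp (- r)"
| "exp_neg \<infinity> = 0"
| "exp_neg (-\<infinity>) = 0"
  by (auto intro: ereal_cases)
termination by standard (rule wf_on_bot)

definition ereal_convex :: "('a::real_vector \<Rightarrow> ereal) \<Rightarrow> bool" where
  "ereal_convex \<phi> \<longleftrightarrow>
     (\<forall>x. \<phi> x \<noteq> -\<infinity>) \<and>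
     (\<forall>x y. \<forall>t\<in>{0<..<1}.
        \<phi> ((1 - t) *\<^sub>R x + t *\<^sub>R y) \<le> ereal (1 - t) * \<phi> x + ereal t * \<phi> y)"

text \<open>Log-concave functions in this sense are nonnegative by definition.\<close>

definition log_concave_fun :: "('a::real_vector \<Rightarrow> real) \<Rightarrow> bool" where
  "log_concave_fun f \<longleftrightarrow> (\<exists>\<phi>. ereal_convex \<phi> \<and> (\<forall>x. f x = exp_neg (\<phi> x)))"

definition upper_semicont :: "('a::topological_space \<Rightarrow> real) \<Rightarrow> bool" where
  "upper_semicont f \<longleftrightarrow> (\<forall>c. open {x. f x < c})"

text \<open>Upper semi-continuous log-concave functions of finite positive integral.\<close>

definition proper_log_concave :: "('a::euclidean_space \<Rightarrow> real) \<Rightarrow> bool" where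
  "proper_log_concave f \<longleftrightarrow>
     upper_semicont f \<and> log_concave_fun f \<and>
     0 < (\<integral>\<^sup>+x. ennreal (f x) \<partial>lborel) \<and> (\<integral>\<^sup>+x. ennreal (f x) \<partial>lborel) < \<infinity>"

text \<open>A function on \<open>[0,\<infinity>)\<close> is represented by a function on \<open>\<real>\<close>, whose values at negative arguments
  are irrelevant.\<close>

definition admissible :: "(real \<Rightarrow> ereal) \<Rightarrow> bool" where
  "admissible \<psi> \<longleftrightarrow>
     (\<forall>t\<ge>0. \<psi> t \<noteq> -\<infinity>) \<and> proper_log_concave (\<lambda>t::real. exp_neg (\<psi> \<bar>t\<bar>))"

definition ellipsoidal_class :: "(real \<Rightarrow> ereal) \<Rightarrow> (real^'n \<Rightarrow> real) set" where
  "ellipsoidal_class \<psi> =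
     {(\<lambda>x. \<alpha> * exp_neg (\<psi> (norm (A *v (x - a))))) | (\<alpha>::real) (A::real^'n^'n) a.
        \<alpha> > 0 \<and> invertible A}"

definition is_min_above ::
  "(real \<Rightarrow> ereal) \<Rightarrow> (real^'n \<Rightarrow> real) \<Rightarrow> (real^'n \<Rightarrow> real) \<Rightarrow> bool" where
  "is_min_above \<psi> f =
     is_arg_min (\<lambda>l. \<integral>\<^sup>+x. ennreal (l x) \<partial>lborel) (\<lambda>l. l \<in> ellipsoidal_class \<psi> \<and> f \<le> l)"

end

theory Submission
  imports Defs
begin

text \<open>Write \<open>g t = e\<^sup>-\<^sup>\<psi>\<^sup>t\<close>. The competitor \<open>\<alpha> g(|A(x - a)|)\<close> has integral \<open>C \<alpha> / |det A|\<close> with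
  \<open>C\<close> depending only on \<open>\<psi>\<close>, so the problem is to minimize \<open>\<alpha> / |det A|\<close>.

  If the height \<open>\<alpha> g(0)\<close> exceeds \<open>e\<^sup>d sup f\<close>, interpolating geometrically between the bounds
  \<open>f \<le> \<alpha> g\<close> and \<open>f \<le> sup f\<close> gives a strictly smaller majorant. This proves the bound on the supremum,
  and it confines minimizing sequences to a compact set of parameters, whence existence.

  For uniqueness, let two majorants be given. Up to rotations, \<open>A\<^sub>1\<close> and \<open>A\<^sub>2\<close> can be diagonalized simultaneously,
  and the midpoint of the matrices and centres with the geometric mean of the heights is a majorant by
  log-concavity; by the inequality of arithmetic and geometric means it is strictly smaller unless
  \<open>|A\<^sub>1 y| = |A\<^sub>2 y|\<close> for all \<open>y\<close>. Two minimizers therefore differ by a translation only. If they are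
  centred at \<open>b \<plusminus> u\<close> and \<open>v = |A u|\<close>, the parallelogram law bounds \<open>f\<close> by
  \<open>\<alpha> g(sqrt(|A(x - b)|\<^sup>2 + v\<^sup>2))\<close>, which leaves room for a smaller majorant centred at \<open>b\<close>.\<close>

section \<open>Singular values\<close>

text \<open>A maximizer \<open>x\<close> of the quadratic form \<open>f y \<bullet> y\<close> over
  the unit sphere of \<open>V\<close> is an eigenvector: the first variation of the form at
  \<open>x\<close> shows that \<open>f x - c *\<^sub>R x\<close> is orthogonal to \<open>V\<close>,
  and by invariance it also lies in \<open>V\<close>.\<close>

lemma selfadjoint_eigenvector:
  fixes f :: "'a::euclidean_space \<Rightarrow> 'a"
  assumes "linear f" and sa: "\<And>x y. f x \<bullet> y = x \<bullet> f y"
    and V: "subspace V" "V \<noteq> {0}" and inv: "f ` V \<subseteq> V"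
  obtains x c where "x \<in> V" "norm x = 1" "f x = c *\<^sub>R x"
proof -
  let ?K = "sphere 0 1 \<inter> V"
  have cf: "continuous_on S f" for S
    using \<open>linear f\<close> by (simp add: linear_continuous_on linear_linear)
  obtain v where v: "v \<in> V" "v \<noteq> 0"
    using V subspace_0 by blast
  then have "v /\<^sub>R norm v \<in> ?K"
    using V by (simp add: subspace_scale)
  moreover have "compact ?K"
    using closed_subspace[OF V(1)] by (simp add: compact_Int_closed)
  ultimately obtain x where x: "x \<in> ?K" and xmax: "\<And>y. y \<in> ?K \<Longrightarrow> f y \<bullet> y \<le> f x \<bullet> x"
    using continuous_attains_sup[of ?K "\<lambda>y. f y \<bullet> y", OF _ _ continuous_on_inner[OF cf continuous_on_id]]
    by blast
  define c where "c = f x \<bullet> x"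
  have xx: "x \<in> V" "x \<bullet> x = 1"
    using x by (auto simp: norm_eq_1)
  have Q: "f z \<bullet> z \<le> c * (z \<bullet> z)" if "z \<in> V" for z
  proof (cases "z = 0")
    case True
    then show ?thesis by (simp add: linear_0[OF \<open>linear f\<close>])
  next
    case False
    let ?z = "z /\<^sub>R norm z"
    have "f ?z \<bullet> ?z \<le> c"
      unfolding c_def using that V False by (intro xmax) (simp add: subspace_scale)
    then have "(f z \<bullet> z) / (norm z)\<^sup>2 \<le> c"
      by (simp add: linear_scale[OF \<open>linear f\<close>] power2_eq_square field_simps)
    then show ?thesis
      using False by (simp add: field_simps power2_norm_eq_inner)
  qed
  have orth: "(f x - c *\<^sub>R x) \<bullet> y = 0" if "y \<in> V" for y
  proof -
    define p where "p = (f x - c *\<^sub>R x) \<bullet> y"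
    define q where "q = c * (y \<bullet> y) - f y \<bullet> y"
    have "0 \<le> t * (t * q - 2 * p)" for t
    proof -
      have "x + t *\<^sub>R y \<in> V"
        using xx that V by (simp add: subspace_add subspace_scale)
      from Q[OF this] have le: "f (x + t *\<^sub>R y) \<bullet> (x + t *\<^sub>R y) \<le> c * ((x + t *\<^sub>R y) \<bullet> (x + t *\<^sub>R y))" .
      have e1: "f (x + t *\<^sub>R y) \<bullet> (x + t *\<^sub>R y) = c + 2 * t * (f x \<bullet> y) + t * t * (f y \<bullet> y)"
        by (simp add: c_def linear_add[OF \<open>linear f\<close>] linear_scale[OF \<open>linear f\<close>] sa[of y x]
            inner_add_left inner_add_right inner_commute[of y "f x"] algebra_simps)
      have e2: "(x + t *\<^sub>R y) \<bullet> (x + t *\<^sub>R y) = 1 + 2 * t * (x \<bullet> y) + t * t * (y \<bullet> y)"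
        by (simp add: inner_add_left inner_add_right inner_commute[of y x] xx(2) distrib_left)
      have "t * (t * q - 2 * p) = c * (1 + 2 * t * (x \<bullet> y) + t * t * (y \<bullet> y))
          - (c + 2 * t * (f x \<bullet> y) + t * t * (f y \<bullet> y))"
        by (simp add: p_def q_def inner_diff_left algebra_simps)
      with le show ?thesis
        unfolding e1 e2 by linarith
    qed
    note nn = this
    have q0: "0 \<le> q"
      using Q[OF that] by (simp add: q_def)
    show ?thesis
    proof (rule ccontr)
      assume "(f x - c *\<^sub>R x) \<bullet> y \<noteq> 0"
      then have p0: "p \<noteq> 0" by (simp add: p_def)
      \<comment> \<open>The nonnegative quadratic \<open>t * (t * q - 2 * p)\<close> is tested at
        \<open>t = p / (q + 1)\<close>. Its minimizer would be \<open>p / q\<close>, but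
        \<open>q\<close> may vanish; the shifted point still makes it negative when \<open>p\<close>
        is nonzero.\<close>
      have eq: "p / (q + 1) * (p / (q + 1) * q - 2 * p) = - (p\<^sup>2 * (q + 2)) / (q + 1)\<^sup>2"
        using q0 by (simp add: field_simps power2_eq_square)
      have "p\<^sup>2 * (q + 2) / (q + 1)\<^sup>2 > 0"
        using p0 q0 by simp
      then show False
        using nn[of "p / (q + 1)"] eq by simp
    qed
  qed
  have "f x - c *\<^sub>R x \<in> V"
    using xx V inv by (simp add: image_subset_iff subspace_diff subspace_scale)
  then have "f x = c *\<^sub>R x"
    using orth by fastforce
  then show ?thesis
    using that x by auto
qed

text \<open>Induction on the dimension: by self-adjointness, the orthogonal complement in
  \<open>V\<close> of an eigenvector is again invariant, and an eigenbasis of it is completed by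
  that eigenvector.\<close>

lemma selfadjoint_eigenbasis:
  fixes f :: "'a::euclidean_space \<Rightarrow> 'a"
  assumes "linear f" and sa: "\<And>x y. f x \<bullet> y = x \<bullet> f y"
    and "subspace V" and "f ` V \<subseteq> V"
  shows "\<exists>E. pairwise orthogonal E \<and> (\<forall>e\<in>E. norm e = 1 \<and> (\<exists>c. f e = c *\<^sub>R e)) \<and> span E = V"
  using assms(3,4)
proof (induction "dim V" arbitrary: V rule: less_induct)
  case less
  show ?case
  proof (cases "V = {0}")
    case True
    then show ?thesis by (intro exI[of _ "{}"]) auto
  next
    case False
    obtain x c where x: "x \<in> V" "norm x = 1" and fx: "f x = c *\<^sub>R x"
      using selfadjoint_eigenvector[OF assms(1) sa less.prems(1) False less.prems(2)] by blast
    define W where "W = V \<inter> {y. x \<bullet> y = 0}"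
    have sub: "subspace W"
      unfolding W_def by (intro subspace_inter less.prems subspace_hyperplane)
    have "f ` W \<subseteq> W"
      using less.prems by (auto simp: W_def sa[symmetric] fx)
    moreover have "dim W < dim V"
    proof (rule dim_psubset)
      have "x \<notin> W" using x by (simp add: W_def norm_eq_1)
      then have "W \<subset> V"
        using x(1) unfolding W_def by blast
      then show "span W \<subset> span V"
        using sub less.prems by (metis span_eq_iff)
    qed
    ultimately obtain E where E: "pairwise orthogonal E"
      "\<forall>e\<in>E. norm e = 1 \<and> (\<exists>c. f e = c *\<^sub>R e)" "span E = W"
      using less.hyps sub by blast
    have Ex: "x \<bullet> e = 0" if "e \<in> E" for e
      using that E(3) span_base by (fastforce simp: W_def)
    have "span (insert x E) = V"
    proof
      show "span (insert x E) \<subseteq> V"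
        using x E(3) span_superset[of E] less.prems by (intro span_minimal) (auto simp: W_def)
      show "V \<subseteq> span (insert x E)"
      proof
        fix y assume y: "y \<in> V"
        have "y - (x \<bullet> y) *\<^sub>R x \<in> W"
          using x y less.prems
          by (auto simp: W_def subspace_diff subspace_scale inner_simps norm_eq_1)
        then show "y \<in> span (insert x E)"
          unfolding span_insert E(3) by blast
      qed
    qed
    moreover have "pairwise orthogonal (insert x E)"
      using E(1) Ex by (auto simp: pairwise_insert orthogonal_def inner_commute)
    ultimately show ?thesis
      using E(2) x fx by (intro exI[of _ "insert x E"]) auto
  qed
qed

abbreviation diag_matrix :: "('n \<Rightarrow> real) \<Rightarrow> real^'n^'n" where
  "diag_matrix s \<equiv> (\<chi> i j. if i = j then s i else 0)"

lemma diag_matrix_vector_mult: "diag_matrix s *v x = (\<chi> i. s i * x $ i)"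
  by (simp add: matrix_vector_mult_def vec_eq_iff if_distrib[of "\<lambda>u. u * _"] cong: if_cong)

lemma det_diag_matrix: "det (diag_matrix s) = prod s UNIV"
  by (simp add: det_diagonal)

lemma norm_orthogonal_matrix_mult:
  fixes Q :: "real^'n^'n"
  assumes "orthogonal_matrix Q"
  shows "norm (Q *v x) = norm x"
  using assms orthogonal_transformation_matrix[of "(*v) Q"]
  by (simp add: orthogonal_transformation)

text \<open>The matrix \<open>A ** B'\<close>, where \<open>B'\<close> inverts \<open>B\<close>,
  preserves norms, hence is orthogonal and has determinant 1 or -1.\<close>

lemma abs_det_eq_if_norm_eq:
  fixes A B :: "real^'n^'n"
  assumes "invertible B" and eq: "\<And>x. norm (A *v x) = norm (B *v x)"
  shows "\<bar>det A\<bar> = \<bar>det B\<bar>"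
proof -
  obtain B' where B': "B ** B' = mat 1" "B' ** B = mat 1"
    using assms(1) invertible_def by blast
  have "norm ((A ** B') *v x) = norm x" for x
    using eq[of "B' *v x"] by (simp add: matrix_vector_mul_assoc B')
  then have "orthogonal_transformation ((*v) (A ** B'))"
    by (simp add: orthogonal_transformation)
  then have "orthogonal_matrix (A ** B')"
    by (simp add: orthogonal_transformation_matrix)
  then have "\<bar>det (A ** B')\<bar> = 1"
    using det_orthogonal_matrix by force
  moreover have "\<bar>det B\<bar> * \<bar>det B'\<bar> = 1"
    using arg_cong[OF B'(1), of det] by (simp add: det_mul flip: abs_mult)
  ultimately show ?thesis
    by (simp add: det_mul abs_mult) (metis mult.right_neutral mult.assoc mult.commute)
qed

text \<open>The spectral theorem applied to the transpose of \<open>B\<close> times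
  \<open>B\<close>. The left orthogonal factor is left out, since only the norms of the vectors
  \<open>B *v x\<close> matter for radial functions.\<close>

lemma singular_value_decomposition:
  fixes B :: "real^'n^'n"
  assumes "invertible B"
  obtains Q s where "orthogonal_matrix Q" "\<And>i. 0 < s i"
    "\<And>x. norm (B *v x) = norm (diag_matrix s *v (Q *v x))"
proof -
  define f where "f = (*v) (transpose B ** B)"
  have ff: "f x \<bullet> y = (B *v x) \<bullet> (B *v y)" for x y
    by (simp add: f_def matrix_vector_mul_assoc[symmetric] dot_lmul_matrix[symmetric]
        transpose_matrix_vector)
  have "linear f"
    by (simp add: f_def)
  moreover have sa: "f x \<bullet> y = x \<bullet> f y" for x y
    by (metis ff inner_commute)
  ultimately obtain E where E: "pairwise orthogonal E"
    "\<forall>e\<in>E. norm e = 1 \<and> (\<exists>c. f e = c *\<^sub>R e)" "span E = UNIV"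
    using selfadjoint_eigenbasis[of f UNIV] by auto
  have "0 \<notin> E" using E(2) by auto
  then have ind: "independent E"
    using E(1) pairwise_orthogonal_independent by blast
  then have "card E = CARD('n)"
    using E(3) dim_eq_card[of E E] dim_UNIV by (metis DIM_cart DIM_real dim_span indep_card_eq_dim_span mult.right_neutral)
  then obtain u where u: "bij_betw u (UNIV::'n set) E"
    by (metis finite_class.finite_UNIV finite_same_card_bij finiteI_independent ind)
  have uE: "u i \<in> E" for i using u bij_betwE by blast
  have "\<forall>i. \<exists>c. f (u i) = c *\<^sub>R u i"
    using E(2) uE by blast
  then obtain c where c: "\<And>i. f (u i) = c i *\<^sub>R u i"
    by (rule choice[THEN exE]) blast
  have nu: "norm (u i) = 1" for i using E(2) uE by blast
  have ou: "orthogonal (u i) (u j)" if "i \<noteq> j" for i j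
    using E(1) u uE that unfolding pairwise_def bij_betw_def inj_on_def by blast
  \<comment> \<open>The rows of \<open>Q\<close> are the eigenvectors, so \<open>Q *v x\<close>
    lists the coordinates of \<open>x\<close> in the eigenbasis.\<close>
  define Q where "Q = (\<chi> i. u i)"
  have Qi: "(Q *v x) $ i = u i \<bullet> x" for x i
    by (simp add: Q_def matrix_vector_mult_def inner_vec_def)
  have Q: "orthogonal_matrix Q"
    by (simp add: orthogonal_matrix_orthonormal_rows Q_def row_def nu ou vec_lambda_eta)
  define s where "s i = norm (B *v u i)" for i
  have c_eq: "c i = (s i)\<^sup>2" for i
    using ff[of "u i" "u i"] nu[of i] by (simp add: c s_def power2_norm_eq_inner norm_eq_1)
  have "0 < s i" for i
  proof -
    have "u i \<noteq> 0" using nu[of i] by auto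
    then have "B *v u i \<noteq> 0"
      using assms by (metis inj_matrix_vector_mult injD matrix_vector_mult_0_right)
    then show ?thesis by (simp add: s_def)
  qed
  moreover have "norm (B *v x) = norm (diag_matrix s *v (Q *v x))" for x
  proof -
    have "(norm (B *v x))\<^sup>2 = f x \<bullet> x"
      by (simp add: ff power2_norm_eq_inner)
    also have "\<dots> = (Q *v f x) \<bullet> (Q *v x)"
      using Q orthogonal_transformation_matrix[of "(*v) Q"] by (simp add: orthogonal_transformation_def)
    also have "\<dots> = (\<Sum>i\<in>UNIV. (s i)\<^sup>2 * ((Q *v x) $ i)\<^sup>2)"
      unfolding inner_vec_def
    proof (intro sum.cong refl)
      fix i
      have "(Q *v f x) $ i = c i * (Q *v x) $ i"
        by (simp add: Qi sa[symmetric] c)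
      then show "(Q *v f x) $ i \<bullet> (Q *v x) $ i = (s i)\<^sup>2 * ((Q *v x) $ i)\<^sup>2"
        by (simp add: c_eq power2_eq_square)
    qed
    also have "\<dots> = (norm (diag_matrix s *v (Q *v x)))\<^sup>2"
      unfolding diag_matrix_vector_mult power2_norm_eq_inner
      by (simp add: inner_vec_def power2_eq_square mult.assoc mult.left_commute)
    finally show ?thesis by (simp add: power2_eq_iff_nonneg)
  qed
  ultimately show ?thesis using Q that by blast
qed

section \<open>Linear change of variables\<close>

text \<open>The corresponding results of HOL-Analysis require a well-ordered index type.\<close>

lemma matrix_vector_mult_borel_measurable [measurable]:
  "(*v) (A :: real^'n^'m) \<in> borel_measurable borel"
  by (intro borel_measurable_continuous_onI linear_continuous_on linear_linear[THEN iffD1])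
    simp

lemma prod_Basis_cart: "prod f (Basis :: (real^'n) set) = (\<Prod>i\<in>UNIV. f (axis i 1))"
proof -
  have "Basis = range (\<lambda>i::'n. axis i (1::real))"
    by (auto simp: Basis_vec_def)
  moreover have "inj (\<lambda>i::'n. axis i (1::real))"
    by (simp add: inj_on_def axis_eq_axis)
  ultimately show ?thesis
    by (metis (no_types, lifting) prod.reindex_cong)
qed

text \<open>A box is carried to the box with two sides exchanged, and the product of the side
  lengths does not depend on their order. As \<open>T\<close> is an involution, preimages of boxes
  are boxes as well.\<close>

lemma lborel_swap:
  fixes T :: "real^'n \<Rightarrow> real^'n"
  assumes T: "\<And>x i. T x $ i = x $ (Transposition.transpose m n i)"
  shows "lborel = distr lborel borel T"
proof (rule lborel_eqI)
  have "linear T"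
    by (rule linearI) (simp_all add: vec_eq_iff T)
  then have [measurable]: "T \<in> borel_measurable borel"
    by (intro borel_measurable_continuous_onI linear_continuous_on) (simp add: linear_linear)
  have TT: "T (T x) = x" for x
    by (simp add: vec_eq_iff T)
  fix l u :: "real^'n" assume le: "\<And>b. b \<in> Basis \<Longrightarrow> l \<bullet> b \<le> u \<bullet> b"
  then have le': "l $ i \<le> u $ i" for i
    using le[of "axis i 1"] by (simp add: inner_axis)
  have "T -` box l u = box (T l) (T u)"
    by (auto simp: mem_box_cart T) (metis transpose_involutory)+
  then have "emeasure (distr lborel borel T) (box l u) = emeasure lborel (box (T l) (T u))"
    by (simp add: emeasure_distr)
  also have "\<dots> = ennreal (\<Prod>i\<in>UNIV. (T u - T l) $ i)"
  proof (subst emeasure_lborel_box)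
    show "T l \<bullet> b \<le> T u \<bullet> b" if "b \<in> Basis" for b
      using that le' by (auto simp: Basis_vec_def inner_axis T)
  qed (simp add: prod_Basis_cart inner_axis)
  also have "(\<Prod>i\<in>UNIV. (T u - T l) $ i) = (\<Prod>i\<in>UNIV. (u - l) $ i)"
    using prod.permute[OF permutes_swap_id, where S=UNIV and g="\<lambda>i. (u - l) $ i"]
    by (simp add: T o_def)
  also have "\<dots> = (\<Prod>b\<in>Basis. (u - l) \<bullet> b)"
    by (simp add: prod_Basis_cart inner_axis)
  finally show "emeasure (distr lborel borel T) (box l u) = ennreal (\<Prod>b\<in>Basis. (u - l) \<bullet> b)" .
qed simp

text \<open>Translation invariance moves the lower corner to 0, where
  \<open>measure_shear_interval\<close> applies.\<close>

lemma measure_shear_cbox: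
  fixes T :: "real^'n \<Rightarrow> real^'n"
  assumes "m \<noteq> n" and T: "T = (\<lambda>x. \<chi> i. if i = m then x $ m + x $ n else x $ i)"
  shows "measure lebesgue (T ` cbox a b) = measure lebesgue (cbox a b)"
proof (cases "cbox a b = {}")
  case False
  have "linear T"
    unfolding T by (rule linearI) (auto simp: vec_eq_iff algebra_simps)
  have eq: "cbox a b = (+) a ` cbox 0 (b - a)"
    by (simp add: cbox_translation[symmetric])
  have "T ` cbox a b = (+) (T a) ` T ` cbox 0 (b - a)"
    unfolding eq image_image by (simp add: linear_add[OF \<open>linear T\<close>])
  then have "measure lebesgue (T ` cbox a b) = measure lebesgue (T ` cbox 0 (b - a))"
    by (simp add: measure_translation)
  also have "\<dots> = measure lebesgue (cbox 0 (b - a))"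
    unfolding T using False eq by (intro measure_shear_interval assms(1)) auto
  also have "\<dots> = measure lebesgue (cbox a b)"
    unfolding eq by (simp add: measure_translation)
  finally show ?thesis .
qed simp

text \<open>The inverse shear \<open>S\<close> comes first, because preimages under \<open>S\<close>
  are images under \<open>T\<close>, whose volume \<open>measure_linear_sufficient\<close> computes
  from that of closed boxes. Pushing the resulting identity forward along \<open>T\<close> gives the
  claim, since \<open>T \<circ> S\<close> is the identity.\<close>

lemma lborel_shear:
  fixes T :: "real^'n \<Rightarrow> real^'n"
  assumes "m \<noteq> n" and T: "T = (\<lambda>x. \<chi> i. if i = m then x $ m + x $ n else x $ i)"
  shows "lborel = distr lborel borel T"
proof -
  define S where "S = (\<lambda>x::real^'n. \<chi> i. if i = m then x $ m - x $ n else x $ i)"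
  have lin: "linear T" "linear S"
    unfolding T S_def by (rule linearI; auto simp: vec_eq_iff algebra_simps)+
  then have [measurable]: "T \<in> borel_measurable borel" "S \<in> borel_measurable borel"
    by (auto intro!: borel_measurable_continuous_onI linear_continuous_on simp: linear_linear)
  have inv: "T (S x) = x" "S (T x) = x" for x
    using assms(1) by (auto simp: T S_def vec_eq_iff)
  have "lborel = distr lborel borel S"
  proof (rule lborel_eqI)
    fix l u :: "real^'n" assume le: "\<And>b. b \<in> Basis \<Longrightarrow> l \<bullet> b \<le> u \<bullet> b"
    have vim: "S -` box l u = T ` box l u"
      using inv by (auto simp: image_iff) metis
    have suff: "T ` box l u \<in> lmeasurable \<and> 1 * measure lebesgue (box l u) = measure lebesgue (T ` box l u)"
      by (rule measure_linear_sufficient)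
        (simp_all add: lin measure_shear_cbox[OF assms])
    have "T ` box l u \<in> sets borel"
      using measurable_sets[of S borel borel "box l u"] by (simp add: vim)
    then have "emeasure (distr lborel borel S) (box l u) = emeasure lebesgue (T ` box l u)"
      by (simp add: emeasure_distr vim)
    also have "\<dots> = emeasure lebesgue (box l u)"
      using suff by (simp add: emeasure_eq_measure2 fmeasurableD2)
    also have "\<dots> = (\<Prod>b\<in>Basis. (u - l) \<bullet> b)"
      using le by (simp add: emeasure_lborel_box)
    finally show "emeasure (distr lborel borel S) (box l u) = ennreal (\<Prod>b\<in>Basis. (u - l) \<bullet> b)" .
  qed simp
  then have "distr lborel borel T = distr (distr lborel borel S) borel T"
    by metis
  also have "\<dots> = distr lborel borel (T \<circ> S)"
    by (simp add: distr_distr)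
  also have "\<dots> = lborel"
    by (simp add: o_def inv distr_id2)
  finally show ?thesis by simp
qed

lemma lborel_stretch:
  fixes s :: "'n::finite \<Rightarrow> real"
  assumes "\<And>i. s i \<noteq> 0"
  shows "lborel = density (distr lborel borel ((*v) (diag_matrix s))) (\<lambda>_. ennreal \<bar>prod s UNIV\<bar>)"
proof -
  define c where "c = (\<lambda>b::real^'n. b \<bullet> (diag_matrix s *v b))"
  have c: "c (axis i 1) = s i" for i
    by (simp add: c_def inner_axis' diag_matrix_vector_mult)
  have "(0 + (\<Sum>j\<in>Basis. (c j * (x \<bullet> j)) *\<^sub>R j)) = diag_matrix s *v x" for x
  proof (rule euclidean_eqI)
    fix b :: "real^'n" assume "b \<in> Basis"
    then obtain i where b: "b = axis i 1"
      by (auto simp: Basis_vec_def)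
    show "(0 + (\<Sum>j\<in>Basis. (c j * (x \<bullet> j)) *\<^sub>R j)) \<bullet> b = (diag_matrix s *v x) \<bullet> b"
      using inner_sum_left_Basis[OF \<open>b \<in> Basis\<close>, of "\<lambda>j. c j * (x \<bullet> j)"]
      by (simp add: b c inner_axis diag_matrix_vector_mult)
  qed
  moreover have "(\<Prod>j\<in>Basis. \<bar>c j\<bar>) = \<bar>prod s UNIV\<bar>"
    by (simp add: prod_Basis_cart c abs_prod)
  moreover have "c j \<noteq> 0" if "j \<in> Basis" for j
    using that assms c by (auto simp: Basis_vec_def)
  ultimately show ?thesis
    using lborel_affine_euclidean[of c 0] by simp
qed

text \<open>The formula is multiplicative in \<open>A\<close>, so it suffices to check it for
  elementary matrices: diagonal ones, transpositions and shears. It is quantified over all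
  measurable \<open>h\<close> so that in a product the second factor can be applied to
  \<open>h\<close> composed with the first. A matrix with a zero row satisfies \<open>P\<close>
  vacuously.\<close>

proposition nn_integral_linear_image:
  fixes A :: "real^'n^'n" and h :: "real^'n \<Rightarrow> ennreal"
  assumes "det A \<noteq> 0" and "h \<in> borel_measurable borel"
  shows "(\<integral>\<^sup>+x. h x \<partial>lborel) = ennreal \<bar>det A\<bar> * (\<integral>\<^sup>+x. h (A *v x) \<partial>lborel)"
proof -
  define P where "P A \<longleftrightarrow> (det A \<noteq> 0 \<longrightarrow> (\<forall>h::real^'n \<Rightarrow> ennreal. h \<in> borel_measurable borel \<longrightarrow>
    (\<integral>\<^sup>+x. h x \<partial>lborel) = ennreal \<bar>det A\<bar> * (\<integral>\<^sup>+x. h (A *v x) \<partial>lborel)))" for A :: "real^'n^'n"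
  have distr: "P A" if "lborel = distr lborel borel ((*v) A)" "\<bar>det A\<bar> = 1" for A
    unfolding P_def
  proof (intro impI allI)
    fix h :: "real^'n \<Rightarrow> ennreal" assume [measurable]: "h \<in> borel_measurable borel"
    have "(\<integral>\<^sup>+x. h x \<partial>lborel) = (\<integral>\<^sup>+x. h x \<partial>distr lborel borel ((*v) A))"
      using that(1) by simp
    then show "(\<integral>\<^sup>+x. h x \<partial>lborel) = ennreal \<bar>det A\<bar> * (\<integral>\<^sup>+x. h (A *v x) \<partial>lborel)"
      by (simp add: nn_integral_distr that(2))
  qed
  have "P A"
  proof (rule induct_matrix_elementary_alt)
    fix A B assume AB: "P A" "P B"
    show "P (A ** B)"
      unfolding P_def
    proof (intro impI allI)
      fix h :: "real^'n \<Rightarrow> ennreal" assume [measurable]: "h \<in> borel_measurable borel" and "det (A ** B) \<noteq> 0"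
      then have d: "det A \<noteq> 0" "det B \<noteq> 0" by (auto simp: det_mul)
      have "(\<integral>\<^sup>+x. h x \<partial>lborel) = ennreal \<bar>det A\<bar> * (\<integral>\<^sup>+x. h (A *v x) \<partial>lborel)"
        by (rule AB(1)[unfolded P_def, rule_format]) (use d in \<open>simp_all\<close>)
      also have "(\<integral>\<^sup>+x. h (A *v x) \<partial>lborel) = ennreal \<bar>det B\<bar> * (\<integral>\<^sup>+x. h (A *v (B *v x)) \<partial>lborel)"
        by (rule AB(2)[unfolded P_def, rule_format]) (use d in \<open>simp_all\<close>)
      finally show "(\<integral>\<^sup>+x. h x \<partial>lborel) = ennreal \<bar>det (A ** B)\<bar> * (\<integral>\<^sup>+x. h (A ** B *v x) \<partial>lborel)"
        by (simp add: det_mul abs_mult ennreal_mult matrix_vector_mul_assoc mult.assoc)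
    qed
  next
    fix A i assume "row i (A :: real^'n^'n) = 0"
    then show "P A" by (simp add: P_def det_zero_row)
  next
    fix A :: "real^'n^'n" assume A: "\<And>i j. i \<noteq> j \<Longrightarrow> A $ i $ j = 0"
    define s where "s i = A $ i $ i" for i
    have A_eq: "A = diag_matrix s"
      using A by (auto simp: vec_eq_iff s_def)
    show "P A"
      unfolding P_def
    proof (intro impI allI)
      fix h :: "real^'n \<Rightarrow> ennreal" assume [measurable]: "h \<in> borel_measurable borel" and d: "det A \<noteq> 0"
      then have s: "s i \<noteq> 0" for i
        by (simp add: A_eq det_diag_matrix)
      have "(\<integral>\<^sup>+x. h x \<partial>lborel) = (\<integral>\<^sup>+x. h x \<partial>density (distr lborel borel ((*v) (diag_matrix s))) (\<lambda>_. ennreal \<bar>prod s UNIV\<bar>))"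
        using lborel_stretch[of s, OF s] by simp
      then show "(\<integral>\<^sup>+x. h x \<partial>lborel) = ennreal \<bar>det A\<bar> * (\<integral>\<^sup>+x. h (A *v x) \<partial>lborel)"
        by (simp add: A_eq det_diag_matrix nn_integral_density nn_integral_distr nn_integral_cmult)
    qed
  next
    fix m n :: 'n assume "m \<noteq> n"
    let ?A = "(\<chi> i j. mat 1 $ i $ Transposition.transpose m n j) :: real^'n^'n"
    show "P ?A"
    proof (rule distr)
      have "(?A *v x) $ i = x $ Transposition.transpose m n i" for x i
      proof -
        have "(?A *v x) $ i = (\<Sum>j\<in>UNIV. if Transposition.transpose m n i = j then x $ j else 0)"
          unfolding matrix_vector_mult_def mat_def vec_lambda_beta
          by (intro sum.cong refl) (metis mult_1 mult_zero_left transpose_involutory)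
        then show ?thesis by simp
      qed
      then show "lborel = distr lborel borel ((*v) ?A)"
        by (rule lborel_swap)
      show "\<bar>det ?A\<bar> = 1"
        by (simp add: det_permute_columns permutes_swap_id sign_swap_id abs_mult)
    qed
  next
    fix m n :: 'n assume "m \<noteq> n"
    let ?A = "(\<chi> i j. of_bool (i = m \<and> j = n \<or> i = j)) :: real^'n^'n"
    show "P ?A"
    proof (rule distr)
      have "?A *v x = (\<chi> i. if i = m then x $ m + x $ n else x $ i)" for x :: "real^'n"
      proof -
        have "(?A *v x) $ i = (\<Sum>j\<in>UNIV. (if j = i then x $ j else 0) + (if j = n then if i = m then x $ j else 0 else 0))" for i
          unfolding matrix_vector_mult_def using \<open>m \<noteq> n\<close>
          by (auto intro!: sum.cong)
        then show ?thesis
          by (simp add: vec_eq_iff sum.distrib)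
      qed
      then show "lborel = distr lborel borel ((*v) ?A)"
        by (intro lborel_shear[OF \<open>m \<noteq> n\<close>]) auto
      have eq: "?A = (\<chi> k. if k = m then row m (mat 1) + 1 *s row n (mat 1) else row k (mat 1))"
        using \<open>m \<noteq> n\<close> by (auto simp: vec_eq_iff row_def mat_def)
      have "det ?A = 1"
        unfolding eq det_row_operation[OF \<open>m \<noteq> n\<close>] by simp
      then show "\<bar>det ?A\<bar> = 1"
        by simp
    qed
  qed
  then show ?thesis
    using assms unfolding P_def by blast
qed

section \<open>Log-concave functions\<close>

lemma log_concave_fun_nonneg: "log_concave_fun f \<Longrightarrow> 0 \<le> f x"
proof -
  have "0 \<le> exp_neg e" for e by (cases e) auto
  then show "log_concave_fun f \<Longrightarrow> 0 \<le> f x"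
    by (auto simp: log_concave_fun_def)
qed

text \<open>The multiplicative form avoids infinite exponents: if \<open>\<phi>\<close> is infinite
  at \<open>x\<close> or \<open>y\<close>, the left side is 0 because \<open>0 powr u = 0\<close>,
  and nonnegativity of \<open>f\<close> suffices.\<close>

lemma log_concave_fun_powr:
  assumes "log_concave_fun f" "0 < t" "t < 1"
  shows "f x powr (1 - t) * f y powr t \<le> f ((1 - t) *\<^sub>R x + t *\<^sub>R y)"
proof -
  obtain \<phi> where \<phi>: "ereal_convex \<phi>" "\<And>x. f x = exp_neg (\<phi> x)"
    using assms(1) by (auto simp: log_concave_fun_def)
  let ?z = "(1 - t) *\<^sub>R x + t *\<^sub>R y"
  have ninf: "\<phi> z \<noteq> -\<infinity>" for z
    using \<phi>(1) by (auto simp: ereal_convex_def)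
  have conv: "\<phi> ?z \<le> ereal (1 - t) * \<phi> x + ereal t * \<phi> y"
    using \<phi>(1) assms by (auto simp: ereal_convex_def)
  have nonneg: "0 \<le> f ?z"
    using assms(1) by (rule log_concave_fun_nonneg)
  consider "\<phi> x = \<infinity>" | "\<phi> y = \<infinity>" | a b where "\<phi> x = ereal a" "\<phi> y = ereal b"
    using ninf[of x] ninf[of y] by (cases "\<phi> x"; cases "\<phi> y"; auto)
  then show ?thesis
  proof cases
    case 3
    then have le: "\<phi> ?z \<le> ereal ((1 - t) * a + t * b)"
      using conv by simp
    then obtain c where c: "\<phi> ?z = ereal c"
      using ninf[of ?z] by (cases "\<phi> ?z") auto
    have "f x powr (1 - t) * f y powr t = exp (- ((1 - t) * a + t * b))"
      by (simp add: \<phi>(2) 3 powr_def exp_add[symmetric] algebra_simps)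
    also have "\<dots> \<le> f ?z"
      using le c by (simp add: \<phi>(2))
    finally show ?thesis .
  qed (use nonneg \<phi> in auto)
qed

lemma upper_semicont_measurable:
  "upper_semicont f \<Longrightarrow> f \<in> borel_measurable borel"
  by (rule borel_measurableI_less) (auto simp: upper_semicont_def)

text \<open>The superlevel sets \<open>S k\<close> are convex. If all were negligible,
  \<open>f\<close> would vanish almost everywhere, against the positive integral; and a convex set
  that is not negligible has interior points. The ball later confines the parameters of the
  majorants to a bounded set.\<close>

lemma log_concave_superlevel_ball:
  fixes f :: "'a::euclidean_space \<Rightarrow> real"
  assumes "proper_log_concave f"
  obtains x r c where "0 < r" "0 < c" "\<And>y. y \<in> ball x r \<Longrightarrow> c \<le> f y"
proof -
  have lc: "log_concave_fun f" and [measurable]: "f \<in> borel_measurable borel"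
    and pos: "0 < (\<integral>\<^sup>+x. ennreal (f x) \<partial>lborel)"
    using assms upper_semicont_measurable by (auto simp: proper_log_concave_def)
  define S where "S k = {x. 1 / real (Suc k) \<le> f x}" for k
  have conv: "convex (S k)" for k
    unfolding convex_alt
  proof (intro ballI allI impI)
    fix x y and u :: real assume xy: "x \<in> S k" "y \<in> S k" and u: "0 \<le> u \<and> u \<le> 1"
    let ?c = "1 / real (Suc k)"
    show "(1 - u) *\<^sub>R x + u *\<^sub>R y \<in> S k"
    proof (cases "u = 0 \<or> u = 1")
      case False
      have "?c = ?c powr (1 - u) * ?c powr u"
        by (simp add: powr_add[symmetric])
      also have "\<dots> \<le> f x powr (1 - u) * f y powr u"
        using xy u by (intro mult_mono powr_mono2) (auto simp: S_def)
      also have "\<dots> \<le> f ((1 - u) *\<^sub>R x + u *\<^sub>R y)"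
        using False u by (intro log_concave_fun_powr lc) auto
      finally show ?thesis by (simp add: S_def)
    qed (use xy in auto)
  qed
  have "\<exists>k. \<not> negligible (S k)"
  proof (rule ccontr)
    assume "\<not> ?thesis"
    then have "negligible (\<Union>k. S k)"
      by (auto intro: negligible_countable_Union)
    then have "(\<Union>k. S k) \<in> null_sets lebesgue"
      by (simp add: negligible_iff_null_sets)
    then have "AE x in lebesgue. x \<notin> (\<Union>k. S k)"
      by (rule AE_not_in)
    then have "AE x in lebesgue. ennreal (f x) = 0"
    proof (rule AE_mp, intro AE_I2 impI)
      fix x assume nS: "x \<notin> (\<Union>k. S k)"
      have "f x \<le> 0"
      proof (rule ccontr)
        assume "\<not> f x \<le> 0"
        then obtain k where "inverse (real (Suc k)) < f x"
          using reals_Archimedean[of "f x"] by auto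
        then have "x \<in> S k" by (simp add: S_def field_simps)
        then show False using nS by blast
      qed
      then show "ennreal (f x) = 0" by (simp add: ennreal_neg)
    qed
    then have "(\<integral>\<^sup>+x. ennreal (f x) \<partial>lebesgue) = 0"
      by (subst nn_integral_0_iff_AE) (auto intro!: measurable_completion)
    then show False
      using pos by (simp add: nn_integral_completion)
  qed
  then obtain k where "interior (S k) \<noteq> {}"
    using negligible_convex_interior[OF conv] by blast
  then obtain x r where "0 < r" "ball x r \<subseteq> S k"
    by (auto simp: mem_interior)
  then show ?thesis
    by (intro that[of r "1 / real (Suc k)" x]) (auto simp: S_def subset_iff)
qed

lemma power_le_fact_exp:
  fixes x :: real
  assumes "0 \<le> x"
  shows "x ^ n \<le> fact n * exp x"
proof -
  have "x ^ n /\<^sub>R fact n \<le> exp x"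
    using sum_le_suminf[OF sums_summable[OF exp_converges[of x]], of "{n}"] assms
      sums_unique[OF exp_converges[of x]] by simp
  then show ?thesis
    by (simp add: field_simps)
qed

text \<open>On the shell with norm between \<open>k\<close> and \<open>k + 1\<close> the integrand
  is at most \<open>exp (- c * k)\<close>, and the shell lies in a ball of volume proportional to
  \<open>(k + 1) ^ DIM('a)\<close>. These products are summable.\<close>

lemma exp_neg_norm_integrable:
  fixes c :: real
  assumes "0 < c"
  shows "(\<integral>\<^sup>+(x::'a::euclidean_space). ennreal (exp (- c * norm x)) \<partial>lborel) < \<infinity>"
proof -
  define V where "V = measure lborel (ball (0::'a) 1)"
  let ?a = "\<lambda>k. exp (- c * real k)"
  have "(\<integral>\<^sup>+(x::'a). ennreal (exp (- c * norm x)) \<partial>lborel)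
    \<le> (\<integral>\<^sup>+x. (\<Sum>k. ennreal (?a k) * indicator (ball (0::'a) (real (Suc k))) x) \<partial>lborel)"
  proof (rule nn_integral_mono)
    fix x :: 'a
    define k where "k = nat \<lfloor>norm x\<rfloor>"
    have k: "real k \<le> norm x" "norm x < real (Suc k)"
      unfolding k_def by (auto simp: of_nat_nat; linarith)+
    have "ennreal (exp (- c * norm x)) \<le> ennreal (?a k) * indicator (ball (0::'a) (real (Suc k))) x"
      using k assms by (auto simp: indicator_def intro!: ennreal_leI)
    also have "\<dots> \<le> (\<Sum>k. ennreal (?a k) * indicator (ball (0::'a) (real (Suc k))) x)"
    proof -
      have "F k \<le> suminf F" for F :: "nat \<Rightarrow> ennreal"
        using sum_le_suminf[of F "{k}"] by simp
      then show ?thesis .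
    qed
    finally show "ennreal (exp (- c * norm x)) \<le> (\<Sum>k. ennreal (?a k) * indicator (ball (0::'a) (real (Suc k))) x)" .
  qed
  also have "\<dots> = (\<Sum>k. ennreal (?a k) * emeasure lborel (ball (0::'a) (real (Suc k))))"
  proof (subst nn_integral_suminf)
    show "(\<lambda>x. ennreal (?a k) * indicator (ball (0::'a) (real (Suc k))) x) \<in> borel_measurable lborel" for k
      by (intro borel_measurable_times_ennreal borel_measurable_const borel_measurable_indicator) simp
  qed (intro suminf_cong nn_integral_cmult_indicator, simp)
  also have "\<dots> = (\<Sum>k. ennreal (?a k * (real (Suc k) ^ DIM('a) * V)))"
  proof (intro suminf_cong)
    fix k
    have "emeasure lborel (ball (0::'a) (real (Suc k))) = ennreal (real (Suc k) ^ DIM('a) * V)"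
      using emeasure_lborel_ball_finite[of "0::'a" "real (Suc k)"]
        content_ball_conv_unit_ball[of "real (Suc k)" "0::'a"]
      by (subst emeasure_eq_ennreal_measure) (auto simp: V_def)
    then show "ennreal (?a k) * emeasure lborel (ball (0::'a) (real (Suc k))) = ennreal (?a k * (real (Suc k) ^ DIM('a) * V))"
      by (simp add: ennreal_mult V_def)
  qed
  also have "\<dots> < \<infinity>"
  proof -
    \<comment> \<open>Half of the exponent absorbs the polynomial factor by
      \<open>power_le_fact_exp\<close>; the other half leaves a geometric series with ratio
      \<open>exp (- (c / 2))\<close>.\<close>
    define K where "K = fact DIM('a) * (2 / c) ^ DIM('a) * exp (c / 2) * V"
    have V: "0 \<le> V" by (simp add: V_def)
    have bound: "?a k * (real (Suc k) ^ DIM('a) * V) \<le> K * exp (- (c / 2)) ^ k" for k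
    proof -
      have le: "((c / 2) * real (Suc k)) ^ DIM('a) \<le> fact DIM('a) * exp ((c / 2) * real (Suc k))"
        using assms by (intro power_le_fact_exp) simp
      have "real (Suc k) ^ DIM('a) \<le> (2 / c) ^ DIM('a) * (fact DIM('a) * exp ((c / 2) * real (Suc k)))"
      proof -
        have "real (Suc k) ^ DIM('a) = (2 / c) ^ DIM('a) * ((c / 2) * real (Suc k)) ^ DIM('a)"
          using assms by (simp del: of_nat_Suc flip: power_mult_distrib)
        then show ?thesis
          using mult_left_mono[OF le, of "(2 / c) ^ DIM('a)"] assms by simp
      qed
      then have "?a k * (real (Suc k) ^ DIM('a) * V)
          \<le> ?a k * ((2 / c) ^ DIM('a) * (fact DIM('a) * exp ((c / 2) * real (Suc k))) * V)"
        using V by (intro mult_left_mono mult_right_mono) auto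
      also have "\<dots> = fact DIM('a) * (2 / c) ^ DIM('a) * V * (?a k * exp ((c / 2) * real (Suc k)))"
        by (simp only: mult_ac)
      also have "?a k * exp ((c / 2) * real (Suc k)) = exp (c / 2) * exp (- (c / 2)) ^ k"
        unfolding exp_of_nat_mult[symmetric] exp_add[symmetric]
        by (simp add: distrib_left mult.commute[of c])
      finally show ?thesis
        by (simp add: K_def mult_ac)
    qed
    have nn: "0 \<le> ?a k * (real (Suc k) ^ DIM('a) * V)" for k
      using V by (intro mult_nonneg_nonneg) auto
    have "summable (\<lambda>k. K * exp (- (c / 2)) ^ k)"
      using assms by (intro summable_mult summable_geometric) simp
    then have "summable (\<lambda>k. ?a k * (real (Suc k) ^ DIM('a) * V))"
      by (rule summable_comparison_test'[where N=0]) (simp only: real_norm_def abs_of_nonneg[OF nn] bound)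
    then show ?thesis
      by (simp only: suminf_ennreal2[OF nn]) simp
  qed
  finally show ?thesis .
qed

section \<open>Radial profiles\<close>

text \<open>The abstract form of \<open>\<lambda>t. exp_neg (\<psi> \<bar>t\<bar>)\<close>. Being
  even and defined on the whole line, \<open>g\<close> yields monotonicity on the half-line from
  log-concavity alone.\<close>

locale radial_profile =
  fixes g :: "real \<Rightarrow> real"
  assumes even: "\<And>t. g (- t) = g t"
    and proper: "proper_log_concave g"
begin

lemma nonneg: "0 \<le> g t"
  using proper log_concave_fun_nonneg[of g t] by (simp add: proper_log_concave_def)

lemma measurable [measurable]: "g \<in> borel_measurable borel"
  using proper by (auto simp: proper_log_concave_def intro: upper_semicont_measurable)

lemma closed_superlevel: "closed {t. c \<le> g t}"
proof -
  have "{t. c \<le> g t} = - {t. g t < c}" by auto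
  then show ?thesis
    using proper by (simp add: proper_log_concave_def upper_semicont_def closed_def)
qed

lemma powr_le: "0 < u \<Longrightarrow> u < 1 \<Longrightarrow> g s powr (1 - u) * g t powr u \<le> g ((1 - u) * s + u * t)"
  using log_concave_fun_powr[of g u s t] proper by (simp add: proper_log_concave_def)

lemma antimono:
  assumes "0 \<le> s" "s \<le> t"
  shows "g t \<le> g s"
proof (cases "s = t")
  case False
  \<comment> \<open>This weight expresses \<open>s\<close> as a convex combination of
    \<open>-t\<close> and \<open>t\<close>, at which \<open>g\<close> takes the same value.\<close>
  define u where "u = (s + t) / (2 * t)"
  have u: "0 < u" "u < 1"
    using assms False by (auto simp: u_def field_simps)
  have "g t = g (- t) powr (1 - u) * g t powr u"
    using nonneg[of t] by (simp add: even powr_add[symmetric])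
  also have "\<dots> \<le> g ((1 - u) * (- t) + u * t)"
    by (intro powr_le u)
  also have "(1 - u) * (- t) + u * t = s"
    using assms False by (simp add: u_def field_simps)
  finally show ?thesis .
qed simp

lemma le_at_0: "g t \<le> g 0"
  using antimono[of 0 t] antimono[of 0 "-t"] even[of t] by (cases "0 \<le> t") auto

lemma pos_at_0: "0 < g 0"
proof (rule ccontr)
  assume "\<not> 0 < g 0"
  then have "g t = 0" for t
    using le_at_0[of t] nonneg[of t] by linarith
  then show False
    using proper by (simp add: proper_log_concave_def)
qed

lemma pos_somewhere: obtains r where "0 < r" "0 < g r"
proof (rule ccontr)
  assume "\<not> thesis"
  with that have no: "0 < r \<Longrightarrow> \<not> 0 < g r" for r by blast
  then have g0: "g t = 0" if "t \<noteq> 0" for t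
    using no[of t] no[of "-t"] even[of t] nonneg[of t] that
    by (cases t "0::real" rule: linorder_cases) (auto simp: order_le_less)
  have "AE t in lborel. t \<noteq> (0::real)"
    by (rule AE_lborel_singleton)
  then have "AE t in lborel. ennreal (g t) = 0"
    by (rule eventually_mono) (simp add: g0)
  then have "(\<integral>\<^sup>+t. ennreal (g t) \<partial>lborel) = 0"
    by (subst nn_integral_0_iff_AE) auto
  then show False
    using proper by (simp add: proper_log_concave_def)
qed

lemma vanishes_at_infinity:
  assumes "0 < c"
  obtains R where "0 < R" "g R < c"
proof (rule ccontr)
  assume "\<not> thesis"
  with that have ge: "0 < t \<Longrightarrow> c \<le> g t" for t by force
  obtain I where I: "0 \<le> I" "(\<integral>\<^sup>+t. ennreal (g t) \<partial>lborel) = ennreal I"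
    using proper by (cases "\<integral>\<^sup>+t. ennreal (g t) \<partial>lborel") (auto simp: proper_log_concave_def)
  have "ennreal (c * real n) \<le> ennreal I" for n
  proof -
    have "ennreal (c * real n) = (\<integral>\<^sup>+t. ennreal c * indicator {0<..<real n} t \<partial>lborel)"
      using assms by (simp add: nn_integral_cmult_indicator ennreal_mult)
    also have "\<dots> \<le> (\<integral>\<^sup>+t. ennreal (g t) \<partial>lborel)"
      by (intro nn_integral_mono) (auto simp: indicator_def intro: ennreal_leI ge)
    finally show ?thesis using I by simp
  qed
  then have "real n \<le> I / c" for n
    using assms I(1) by (simp add: field_simps)
  then show False
    using reals_Archimedean2[of "I / c"] by (meson not_le)
qed

text \<open>If \<open>g\<close> has dropped below \<open>g 0 / e\<close> at \<open>R\<close>, then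
  log-concavity along 0, \<open>R\<close>, \<open>t\<close> makes it drop by at least that factor
  per length \<open>R\<close> beyond \<open>R\<close>. The extra factor \<open>exp 1\<close> covers
  the range up to \<open>R\<close>, where only \<open>g t \<le> g 0\<close> is used.\<close>

lemma exponential_decay:
  obtains K c where "0 < c" "\<And>t. 0 \<le> t \<Longrightarrow> g t \<le> K * exp (- c * t)"
proof -
  obtain R where R: "0 < R" "g R < g 0 * exp (- 1)"
    using vanishes_at_infinity[of "g 0 * exp (- 1)"] pos_at_0 by auto
  have "g t \<le> g 0 * exp 1 * exp (- (1 / R) * t)" if "0 \<le> t" for t
  proof (cases "t \<le> R")
    case True
    then have "1 \<le> exp 1 * exp (- (1 / R) * t)"
      using R by (simp add: exp_add[symmetric] field_simps)
    then have "g 0 \<le> g 0 * (exp 1 * exp (- (1 / R) * t))"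
      using pos_at_0 by simp
    then show ?thesis
      using le_at_0[of t] by (simp add: mult.assoc)
  next
    case False
    \<comment> \<open>With this weight \<open>R\<close> is the convex combination of 0 and
      \<open>t\<close>.\<close>
    define u where "u = R / t"
    have u: "0 < u" "u < 1" "t * u = R" "0 < t"
      using False R by (auto simp: u_def)
    have "g 0 powr (1 - u) * g t powr u \<le> g R"
      using powr_le[OF u(1,2), of 0 t] u(3) by (simp add: mult.commute)
    also have "\<dots> \<le> g 0 * exp (- 1)"
      using R by simp
    also have "\<dots> = g 0 powr (1 - u) * (g 0 * exp (- (1 / u))) powr u"
      using pos_at_0 u by (simp add: powr_mult powr_diff exp_powr_real)
    finally have "g t powr u \<le> (g 0 * exp (- (1 / u))) powr u"
      using pos_at_0 by simp
    then have "g t \<le> g 0 * exp (- (1 / u))"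
      using powr_less_mono2[OF u(1), of "g 0 * exp (- (1 / u))" "g t"] pos_at_0 by fastforce
    also have "1 / u = (1 / R) * t"
      using u R by (simp add: u_def)
    also have "g 0 * exp (- ((1 / R) * t)) \<le> g 0 * exp 1 * exp (- (1 / R) * t)"
      using pos_at_0 by simp
    finally show ?thesis .
  qed
  then show ?thesis
    using that[of "1 / R"] R by auto
qed

text \<open>The type argument carries the dimension. The integral is finite by the next lemma, so
  \<open>enn2real\<close> loses nothing.\<close>

definition mass :: "'n::finite itself \<Rightarrow> real" where
  "mass _ = enn2real (\<integral>\<^sup>+(x::real^'n). ennreal (g (norm x)) \<partial>lborel)"

lemma nn_integral_radial:
  "(\<integral>\<^sup>+(x::real^'n). ennreal (g (norm x)) \<partial>lborel) = ennreal (mass TYPE('n))"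
  and mass_pos: "0 < mass TYPE('n)"
proof -
  let ?I = "\<integral>\<^sup>+(x::real^'n). ennreal (g (norm x)) \<partial>lborel"
  obtain K c where Kc: "0 < c" "\<And>t. 0 \<le> t \<Longrightarrow> g t \<le> K * exp (- c * t)"
    using exponential_decay by blast
  have "?I \<le> (\<integral>\<^sup>+(x::real^'n). ennreal K * ennreal (exp (- c * norm x)) \<partial>lborel)"
  proof (rule nn_integral_mono)
    fix x :: "real^'n"
    have "0 \<le> K" using Kc(2)[of 0] nonneg[of 0] by simp
    then show "ennreal (g (norm x)) \<le> ennreal K * ennreal (exp (- c * norm x))"
      using Kc(2)[of "norm x"] by (simp add: ennreal_mult[symmetric] ennreal_leI)
  qed
  also have "\<dots> = ennreal K * (\<integral>\<^sup>+(x::real^'n). ennreal (exp (- c * norm x)) \<partial>lborel)"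
    by (rule nn_integral_cmult) measurable
  also have "\<dots> < \<infinity>"
    using exp_neg_norm_integrable[OF Kc(1), where 'a="real^'n"] by (simp add: ennreal_mult_less_top)
  finally have fin: "?I < \<infinity>" .
  then show eq: "?I = ennreal (mass TYPE('n))"
    by (simp add: mass_def)
  obtain r where r: "0 < r" "0 < g r"
    using pos_somewhere by blast
  have "0 < emeasure lborel (ball (0::real^'n) r)"
    using content_ball_pos[OF r(1), of "0::real^'n"] by (simp add: measure_def enn2real_positive_iff)
  then have "0 < ennreal (g r) * emeasure lborel (ball (0::real^'n) r)"
    using r by (simp add: ennreal_zero_less_mult_iff)
  also have "\<dots> = (\<integral>\<^sup>+(x::real^'n). ennreal (g r) * indicator (ball 0 r) x \<partial>lborel)"
    by (simp add: nn_integral_cmult_indicator)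
  also have "\<dots> \<le> ?I"
    by (intro nn_integral_mono) (auto simp: indicator_def intro!: ennreal_leI antimono)
  finally show "0 < mass TYPE('n)"
    by (simp add: eq)
qed

lemma nn_integral_ellipsoidal:
  fixes A :: "real^'n^'n"
  assumes "0 < \<alpha>" "invertible A"
  shows "(\<integral>\<^sup>+x. ennreal (\<alpha> * g (norm (A *v (x - a)))) \<partial>lborel)
    = ennreal (\<alpha> / \<bar>det A\<bar> * mass TYPE('n))"
proof -
  have d: "det A \<noteq> 0" using assms by (simp add: invertible_det_nz)
  let ?J = "\<integral>\<^sup>+x. ennreal (\<alpha> * g (norm (A *v x))) \<partial>lborel"
  have "(\<integral>\<^sup>+x. ennreal (\<alpha> * g (norm (A *v (x - a)))) \<partial>lborel)
    = (\<integral>\<^sup>+x. ennreal (\<alpha> * g (norm (A *v (x - a)))) \<partial>distr lborel borel ((+) a))"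
    by (simp only: lborel_distr_plus)
  also have "\<dots> = ?J"
    by (subst nn_integral_distr) auto
  finally have 1: "(\<integral>\<^sup>+x. ennreal (\<alpha> * g (norm (A *v (x - a)))) \<partial>lborel) = ?J" .
  have "ennreal \<bar>det A\<bar> * ?J = (\<integral>\<^sup>+(x::real^'n). ennreal (\<alpha> * g (norm x)) \<partial>lborel)"
    by (rule nn_integral_linear_image[OF d, symmetric]) measurable
  also have "\<dots> = ennreal \<alpha> * ennreal (mass TYPE('n))"
    using assms(1) nonneg by (simp add: ennreal_mult' nn_integral_cmult nn_integral_radial)
  finally have "ennreal (1 / \<bar>det A\<bar>) * (ennreal \<bar>det A\<bar> * ?J) = ennreal (1 / \<bar>det A\<bar>) * (ennreal \<alpha> * ennreal (mass TYPE('n)))"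
    by simp
  moreover have "ennreal (1 / \<bar>det A\<bar>) * ennreal \<bar>det A\<bar> = 1"
    using d by (simp add: ennreal_mult'[symmetric])
  ultimately have "?J = ennreal (1 / \<bar>det A\<bar>) * (ennreal \<alpha> * ennreal (mass TYPE('n)))"
    by (simp add: mult.assoc[symmetric])
  also have "\<dots> = ennreal (\<alpha> / \<bar>det A\<bar> * mass TYPE('n))"
    using assms(1) mass_pos[where 'n='n] by (simp add: ennreal_mult'[symmetric])
  finally show ?thesis
    using 1 by simp
qed

end

section \<open>Majorants and the reduction of their height\<close>

lemma diag_matrix_const_mult: "(diag_matrix (\<lambda>_. c) ** A) *v x = c *\<^sub>R (A *v x)"
  by (simp add: matrix_vector_mul_assoc[symmetric] diag_matrix_vector_mult vec_eq_iff)

lemma det_diag_matrix_const_mult: "det (diag_matrix (\<lambda>_. c) ** A) = c ^ CARD('n) * det (A::real^'n^'n)"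
  by (simp add: det_mul det_diag_matrix)

context radial_profile
begin

definition majorizes :: "real \<Rightarrow> real^'n^'n \<Rightarrow> real^'n \<Rightarrow> (real^'n \<Rightarrow> real) \<Rightarrow> bool" where
  "majorizes \<alpha> A a f \<longleftrightarrow> 0 < \<alpha> \<and> det A \<noteq> 0 \<and> (\<forall>x. f x \<le> \<alpha> * g (norm (A *v (x - a))))"

text \<open>By \<open>nn_integral_ellipsoidal\<close> the quotient compared here is the integral
  divided by the constant \<open>mass\<close>.\<close>

definition least_majorant :: "real \<Rightarrow> real^'n^'n \<Rightarrow> real^'n \<Rightarrow> (real^'n \<Rightarrow> real) \<Rightarrow> bool" where
  "least_majorant \<alpha> A a f \<longleftrightarrow> majorizes \<alpha> A a f \<and>
    (\<forall>\<beta> B b. majorizes \<beta> B b f \<longrightarrow> \<alpha> / \<bar>det A\<bar> \<le> \<beta> / \<bar>det B\<bar>)"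

text \<open>Splitting \<open>f x\<close> as
  \<open>f x powr (1 - \<theta>) * f x powr \<theta>\<close> and using the bound \<open>m\<close>
  for the first factor and the majorant for the second gives a bound of the form
  \<open>g 0 powr (1 - \<theta>) * g t powr \<theta>\<close>, up to a constant. Log-concavity turns
  it into a value of \<open>g\<close> at \<open>\<theta> * t\<close>: lower height, wider
  profile.\<close>

lemma lower_height:
  fixes A :: "real^'n^'n"
  assumes maj: "majorizes \<alpha> A a f"
    and f: "\<And>x. 0 \<le> f x" "\<And>x. f x \<le> m" and "0 < m"
    and high: "exp 1 ^ CARD('n) * m < \<alpha> * g 0"
  obtains \<beta> B where "majorizes \<beta> B a f" "\<beta> * g 0 = exp 1 ^ CARD('n) * m"
    "\<beta> / \<bar>det B\<bar> < \<alpha> / \<bar>det A\<bar>"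
proof -
  define d where "d = real CARD('n)"
  define S where "S = ln (\<alpha> * g 0 / m)"
  \<comment> \<open>The new height is \<open>m * exp (S * \<theta>)\<close>, which this choice makes
    equal to \<open>m * exp d\<close>. It also minimizes the factor
    \<open>exp (S * (\<theta> - 1)) / \<theta> ^ CARD('n)\<close> by which the integral
    changes.\<close>
  define \<theta> where "\<theta> = d / S"
  have \<alpha>: "0 < \<alpha>" "det A \<noteq> 0" "\<And>x. f x \<le> \<alpha> * g (norm (A *v (x - a)))"
    using maj by (auto simp: majorizes_def)
  have d: "0 < d" by (simp add: d_def)
  have ed: "exp 1 ^ CARD('n) = exp d"
    by (simp add: d_def exp_of_nat_mult[symmetric])
  have eS: "\<alpha> * g 0 = m * exp S"
    using \<alpha>(1) pos_at_0 \<open>0 < m\<close> by (simp add: S_def)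
  then have "m * exp d < m * exp S"
    using high by (simp add: ed mult.commute)
  then have S: "d < S"
    using \<open>0 < m\<close> by simp
  then have \<theta>: "0 < \<theta>" "\<theta> < 1" "S * \<theta> = d"
    using d by (auto simp: \<theta>_def)
  define \<beta> where "\<beta> = \<alpha> * exp (d - S)"
  define B where "B = diag_matrix (\<lambda>_. \<theta>) ** A"
  have detB: "det B = \<theta> ^ CARD('n) * det A"
    by (simp add: B_def det_diag_matrix_const_mult)
  have "f x \<le> \<beta> * g (norm (B *v (x - a)))" for x
  proof (cases "f x = 0")
    case True
    then show ?thesis using \<alpha>(1) nonneg by (simp add: \<beta>_def)
  next
    case False
    let ?t = "norm (A *v (x - a))"
    have pf: "0 < f x" using False f(1)[of x] by simp
    have "f x = f x powr (1 - \<theta>) * f x powr \<theta>"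
      using pf by (simp add: powr_add[symmetric])
    also have "\<dots> \<le> m powr (1 - \<theta>) * (\<alpha> * g ?t) powr \<theta>"
      using pf \<theta> f(2)[of x] \<alpha>(3)[of x] by (intro mult_mono powr_mono2) auto
    also have "\<dots> = \<beta> * (g 0 powr (1 - \<theta>) * g ?t powr \<theta>)"
    proof -
      have "m = \<alpha> * g 0 * exp (- S)"
        by (simp add: eS mult.assoc exp_add[symmetric])
      then have "m powr (1 - \<theta>) = \<alpha> powr (1 - \<theta>) * g 0 powr (1 - \<theta>) * exp (- S * (1 - \<theta>))"
        using \<alpha>(1) pos_at_0 by (simp add: powr_mult exp_powr_real)
      moreover have "- S * (1 - \<theta>) = d - S"
        using \<theta>(3) by (simp add: algebra_simps)
      moreover have "\<alpha> powr (1 - \<theta>) * \<alpha> powr \<theta> = \<alpha>"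
        using \<alpha>(1) by (simp add: powr_add[symmetric])
      ultimately show ?thesis
        using \<alpha>(1) nonneg by (simp add: \<beta>_def powr_mult)
    qed
    also have "\<dots> \<le> \<beta> * g ((1 - \<theta>) * 0 + \<theta> * ?t)"
      using \<alpha>(1) by (intro mult_left_mono powr_le \<theta>) (simp add: \<beta>_def)
    also have "(1 - \<theta>) * 0 + \<theta> * ?t = norm (B *v (x - a))"
      using \<theta>(1) by (simp add: B_def diag_matrix_const_mult)
    finally show ?thesis .
  qed
  then have "majorizes \<beta> B a f"
    using \<alpha> \<theta>(1) by (simp add: majorizes_def detB \<beta>_def)
  moreover have "\<beta> * g 0 = exp 1 ^ CARD('n) * m"
  proof -
    have "\<beta> * g 0 = m * (exp S * exp (d - S))"
      using eS by (simp add: \<beta>_def mult_ac)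
    then show ?thesis by (simp add: ed exp_add[symmetric])
  qed
  moreover have "\<beta> / \<bar>det B\<bar> < \<alpha> / \<bar>det A\<bar>"
  proof -
    \<comment> \<open>The logarithm of the factor gained in the integral is
      \<open>d - S - d * ln \<theta>\<close>, that is, \<open>d\<close> times
      \<open>1 - S / d + ln (S / d)\<close>. It is negative because \<open>S / d\<close> differs
      from 1.\<close>
    have "ln (S / d) < S / d - 1"
      using ln_le_minus_one[of "S / d"] ln_eq_minus_one[of "S / d"] S d
      by (metis antisym_conv2 div_by_1 divide_pos_pos less_irrefl less_trans nonzero_eq_divide_eq mult_1)
    then have "d - S < d * ln \<theta>"
      using S d by (simp add: \<theta>_def ln_div field_simps)
    then have "exp (d - S) < \<theta> ^ CARD('n)"
      using \<theta>(1) by (metis d_def exp_less_mono exp_of_nat_mult exp_ln)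
    then have "exp (d - S) / \<theta> ^ CARD('n) < 1"
      using \<theta>(1) by simp
    moreover have "0 < \<alpha> / \<bar>det A\<bar>"
      using \<alpha> by simp
    ultimately have "(\<alpha> / \<bar>det A\<bar>) * (exp (d - S) / \<theta> ^ CARD('n)) < \<alpha> / \<bar>det A\<bar>"
      by (metis mult.right_neutral mult_strict_left_mono)
    then show ?thesis
      using \<theta>(1) by (simp add: detB \<beta>_def abs_mult mult_ac)
  qed
  ultimately show ?thesis by (rule that)
qed

end

section \<open>Existence of a minimizer by compactness\<close>

lemma continuous_on_det [continuous_intros]:
  fixes F :: "'a::topological_space \<Rightarrow> real^'n^'n"
  assumes "continuous_on S F"
  shows "continuous_on S (\<lambda>x. det (F x))"
  unfolding det_def by (intro continuous_intros assms)

lemma norm_matrix_le_sum: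
  fixes A :: "real^'n^'m"
  shows "norm A \<le> (\<Sum>i\<in>UNIV. \<Sum>j\<in>UNIV. \<bar>A $ i $ j\<bar>)"
proof -
  have "norm A \<le> (\<Sum>i\<in>UNIV. norm (A $ i))"
    unfolding norm_vec_def[of A] by (rule L2_set_le_sum) simp
  also have "\<dots> \<le> (\<Sum>i\<in>UNIV. \<Sum>j\<in>UNIV. \<bar>A $ i $ j\<bar>)"
    by (intro sum_mono norm_le_l1_cart)
  finally show ?thesis .
qed

context radial_profile
begin

text \<open>The set \<open>K\<close> of competitors of height at most \<open>M\<close> and value at
  most \<open>J\<close> is compact. The centre enters through \<open>b = A *v a\<close>, which is
  bounded directly, with no control of the inverse of \<open>A\<close>.\<close>

lemma least_volume_attained_below_height:
  fixes f :: "real^'n \<Rightarrow> real"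
  assumes f: "0 < r" "0 < c" "\<And>y. y \<in> ball z r \<Longrightarrow> c \<le> f y" and "0 < M" "0 < J"
    and p0: "\<alpha>0 * g 0 \<le> M" "\<alpha>0 \<le> J * \<bar>det A0\<bar>" "\<And>x. f x \<le> \<alpha>0 * g (norm (A0 *v x - b0))"
  obtains \<alpha> A b where "0 < \<alpha>" "det A \<noteq> 0" "\<And>x. f x \<le> \<alpha> * g (norm (A *v x - b))"
    "\<And>\<beta> B b'. \<beta> * g 0 \<le> M \<Longrightarrow> \<beta> \<le> J * \<bar>det B\<bar> \<Longrightarrow>
      (\<And>x. f x \<le> \<beta> * g (norm (B *v x - b'))) \<Longrightarrow> \<alpha> / \<bar>det A\<bar> \<le> \<beta> / \<bar>det B\<bar>"
proof -
  \<comment> \<open>The lower bound on \<open>\<alpha>\<close> is forced by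
    \<open>f z \<ge> c\<close>. Together with \<open>\<alpha> \<le> J * \<bar>det A\<bar>\<close> it
    excludes singular limits while keeping every condition closed.\<close>
  define K where "K = {(\<alpha>, A :: real^'n^'n, b). \<alpha> \<in> {c / g 0..M / g 0} \<and> \<alpha> \<le> J * \<bar>det A\<bar> \<and>
    (\<forall>x. f x \<le> \<alpha> * g (norm (A *v x - b)))}"
  have memK: "(\<alpha>, A, b) \<in> K" if "\<alpha> * g 0 \<le> M" "\<alpha> \<le> J * \<bar>det A\<bar>"
    "\<And>x. f x \<le> \<alpha> * g (norm (A *v x - b))" for \<alpha> A b
  proof -
    have "c \<le> \<alpha> * g (norm (A *v z - b))"
      using f(3)[of z] that(3)[of z] f(1) by simp
    then have "0 < \<alpha>"
      using f(2) nonneg[of "norm (A *v z - b)"]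
      by (meson less_le_trans mult_nonpos_nonneg not_le)
    then have "\<alpha> * g (norm (A *v z - b)) \<le> \<alpha> * g 0"
      by (simp add: le_at_0)
    then show ?thesis
      using \<open>c \<le> _\<close> that pos_at_0 by (simp add: K_def field_simps)
  qed
  have pos: "0 < \<alpha>" if "(\<alpha>, A, b) \<in> K" for \<alpha> A b
    using that f(2) pos_at_0 by (auto simp: K_def intro: less_le_trans[of 0 "c / g 0"])
  have "bounded K"
  proof -
    \<comment> \<open>Since \<open>\<alpha> \<le> M / g 0\<close> on \<open>K\<close>, a point with
      \<open>norm (A *v x - b) \<ge> R\<close> would have a majorant value below \<open>c\<close>,
      which is impossible on the ball.\<close>
    obtain R where R: "0 < R" "g R < c * g 0 / M"
      using vanishes_at_infinity[of "c * g 0 / M"] f(2) pos_at_0 \<open>0 < M\<close> by auto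
    have close: "norm (A *v x - b) < R" if K: "(\<alpha>, A, b) \<in> K" and x: "x \<in> ball z r" for \<alpha> A b x
    proof (rule ccontr)
      assume "\<not> ?thesis"
      then have "g (norm (A *v x - b)) \<le> g R"
        using R by (intro antimono) auto
      also note R(2)
      finally have "\<alpha> * g (norm (A *v x - b)) < \<alpha> * (c * g 0 / M)"
        by (rule mult_strict_left_mono[OF _ pos[OF K]])
      also have "\<dots> \<le> (M / g 0) * (c * g 0 / M)"
        using K f(2) pos_at_0 \<open>0 < M\<close> by (intro mult_right_mono) (auto simp: K_def)
      also have "\<dots> = c"
        using pos_at_0 \<open>0 < M\<close> by simp
      also have "c \<le> f x" using x by (rule f(3))
      also have "\<dots> \<le> \<alpha> * g (norm (A *v x - b))"
        using K by (simp add: K_def)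
      finally show False by simp
    qed
    \<comment> \<open>Points of the ball at distance \<open>r / 2\<close> have images less than
      \<open>2 * R\<close> apart, so \<open>A\<close> stretches vectors by at most
      \<open>2 * R / (r / 2)\<close>.\<close>
    define L where "L = 4 * R / r"
    have lin: "norm (A *v h) \<le> L * norm h" if K: "(\<alpha>, A, b) \<in> K" for \<alpha> A b h
    proof (cases "h = 0")
      case False
      define k where "k = (r / 2 / norm h) *\<^sub>R h"
      have "norm k < r"
        using False f(1) by (simp add: k_def)
      then have "z + k \<in> ball z r" by (simp add: dist_norm)
      then have "norm (A *v (z + k) - b) < R" "norm (A *v z - b) < R"
        using close[OF K] f(1) by auto
      then have "norm ((A *v (z + k) - b) - (A *v z - b)) < R + R"
        by (intro norm_triangle_lt[of _ "- _", simplified norm_minus_cancel diff_conv_add_uminus[symmetric]]) simp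
      then have "norm (A *v k) < 2 * R"
        by (simp add: matrix_vector_right_distrib)
      also have "norm (A *v k) = (r / 2 / norm h) * norm (A *v h)"
        using f(1) by (simp add: k_def matrix_vector_mult_scaleR)
      finally show ?thesis
        using False f(1) by (simp add: L_def field_simps)
    qed (simp add: L_def)
    have entries: "\<bar>A $ i $ j\<bar> \<le> L" if K: "(\<alpha>, A, b) \<in> K" for \<alpha> A b i j
    proof -
      have "\<bar>A $ i $ j\<bar> = \<bar>(A *v axis j 1) $ i\<bar>"
        by (simp add: matrix_vector_mult_basis column_def)
      also have "\<dots> \<le> L"
        using component_le_norm_cart[of "A *v axis j 1" i] lin[OF K, of "axis j 1"] by simp
      finally show ?thesis .
    qed
    have "K \<subseteq> {c / g 0..M / g 0} \<times> (cball 0 (\<Sum>i\<in>(UNIV::'n set). \<Sum>j\<in>(UNIV::'n set). L) \<times> cball 0 (R + L * norm z))"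
    proof
      fix p assume "p \<in> K"
      moreover obtain \<alpha> A b where p: "p = (\<alpha>, A, b)" by (cases p)
      ultimately have K: "(\<alpha>, A, b) \<in> K" by simp
      have "norm A \<le> (\<Sum>i\<in>(UNIV::'n set). \<Sum>j\<in>(UNIV::'n set). L)"
        using norm_matrix_le_sum[of A] by (rule order_trans) (intro sum_mono entries[OF K])
      moreover have "norm b \<le> R + L * norm z"
        using close[OF K, of z] f(1) lin[OF K, of z] norm_triangle_sub[of b "A *v z"]
        by (simp add: norm_minus_commute)
      ultimately show "p \<in> {c / g 0..M / g 0} \<times> (cball 0 (\<Sum>i\<in>(UNIV::'n set). \<Sum>j\<in>(UNIV::'n set). L) \<times> cball 0 (R + L * norm z))"
        using K by (simp add: p K_def)
    qed
    then show ?thesis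
      by (rule bounded_subset[rotated]) (intro bounded_Times bounded_closed_interval bounded_cball)
  qed
  moreover have "closed K"
  proof -
    define T where "T x p = norm (fst (snd p) *v x - snd (snd p))" for x :: "real^'n" and p :: "real \<times> (real^'n^'n) \<times> (real^'n)"
    have cT: "continuous_on UNIV (T x)" for x
      unfolding T_def matrix_vector_mult_def
      by (intro continuous_intros continuous_on_vec_lambda)
    \<comment> \<open>\<open>g\<close> is only upper semicontinuous, so the constraint is split into closed conditions.\<close>
    have eq: "K = {p. c / g 0 \<le> fst p} \<inter> {p. fst p \<le> M / g 0} \<inter> {p. fst p \<le> J * \<bar>det (fst (snd p))\<bar>} \<inter>
      (\<Inter>x. \<Inter>e. T x -` {t. e \<le> g t} \<union> {p. f x \<le> fst p * e})" (is "_ = ?R")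
    proof (intro subset_antisym subsetI)
      fix p assume p: "p \<in> K"
      then have "0 < fst p" using pos by (cases p) auto
      have fT: "f x \<le> fst p * g (T x p)" for x
        using p by (auto simp: K_def T_def split_beta)
      have "e \<le> g (T x p) \<or> f x \<le> fst p * e" for x e
      proof (cases "e \<le> g (T x p)")
        case False
        then have "fst p * g (T x p) \<le> fst p * e"
          using \<open>0 < fst p\<close> by simp
        then show ?thesis
          using fT[of x] by simp
      qed simp
      then show "p \<in> ?R"
        using p by (auto simp: K_def)
    next
      fix p assume p: "p \<in> ?R"
      then have p0: "0 < fst p"
        using f(2) pos_at_0 by (auto intro: less_le_trans[of 0 "c / g 0"])
      have "f x \<le> fst p * g (T x p)" for x
      proof (rule ccontr)
        assume "\<not> ?thesis"
        then have "g (T x p) < f x / fst p"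
          using p0 by (simp add: field_simps)
        then obtain e where "g (T x p) < e" "e < f x / fst p"
          using dense by blast
        then show False
          using p p0 by (auto simp: field_simps not_le dest!: spec[of _ x] spec[of _ e])
      qed
      then show "p \<in> K"
        using p by (auto simp: K_def T_def split_beta)
    qed
    have cdet: "continuous_on UNIV (\<lambda>p::real \<times> (real^'n^'n) \<times> (real^'n). det (fst (snd p)))"
      by (intro continuous_intros)
    show ?thesis
      unfolding eq
      by (intro closed_Int closed_INT closed_Un ballI closed_Collect_le continuous_intros cdet
          closed_vimage[OF closed_superlevel] cT)
  qed
  ultimately have "compact K"
    by (simp add: compact_eq_bounded_closed)
  moreover have "K \<noteq> {}"
    using memK[OF p0] by auto
  moreover have detK: "det (fst (snd p)) \<noteq> 0" if "p \<in> K" for p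
    using that pos[of "fst p" "fst (snd p)" "snd (snd p)"] by (auto simp: K_def)
  then have "continuous_on K (\<lambda>p. fst p / \<bar>det (fst (snd p))\<bar>)"
    by (intro continuous_intros) auto
  ultimately obtain p where p: "p \<in> K" and min: "\<And>q. q \<in> K \<Longrightarrow> fst p / \<bar>det (fst (snd p))\<bar> \<le> fst q / \<bar>det (fst (snd q))\<bar>"
    using continuous_attains_inf[of K "\<lambda>p. fst p / \<bar>det (fst (snd p))\<bar>"] by blast
  obtain \<alpha> A b where pe: "p = (\<alpha>, A, b)"
    by (cases p)
  show ?thesis
  proof (rule that[of \<alpha> A b])
    show "0 < \<alpha>" "det A \<noteq> 0" "f x \<le> \<alpha> * g (norm (A *v x - b))" for x
      using p pos detK[OF p] by (auto simp: pe K_def)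
    show "\<alpha> / \<bar>det A\<bar> \<le> \<beta> / \<bar>det B\<bar>" if "\<beta> * g 0 \<le> M" "\<beta> \<le> J * \<bar>det B\<bar>"
      "\<And>x. f x \<le> \<beta> * g (norm (B *v x - b'))" for \<beta> B b'
      using min[OF memK[OF that]] by (simp add: pe)
  qed
qed

text \<open>By \<open>lower_height\<close> each majorant can be replaced by one of height at most
  \<open>M\<close> whose value is no larger, and one such replacement supplies the bound
  \<open>J\<close>. Competitors with value above \<open>J\<close> cannot beat the minimizer found
  below it.\<close>

proposition exists_least_majorant:
  fixes f :: "real^'n \<Rightarrow> real"
  assumes f: "proper_log_concave f" and maj0: "majorizes \<alpha>0 A0 a0 f"
  shows "\<exists>\<alpha> A a. least_majorant \<alpha> A a f"
proof -
  obtain z r c where zrc: "0 < r" "0 < c" "\<And>y. y \<in> ball z r \<Longrightarrow> c \<le> f y"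
    by (rule log_concave_superlevel_ball[OF f]) iprover
  have "log_concave_fun f"
    using f by (simp add: proper_log_concave_def)
  then have fnn: "0 \<le> f x" for x
    by (rule log_concave_fun_nonneg)
  \<comment> \<open>Any positive upper bound of \<open>f\<close> serves here; it need not be the
    supremum.\<close>
  define m where "m = \<alpha>0 * g 0"
  define M where "M = exp 1 ^ CARD('n) * m"
  have fm: "f x \<le> m" for x
    using maj0 le_at_0[of "norm (A0 *v (x - a0))"] unfolding m_def majorizes_def
    by (meson less_imp_le mult_left_mono order_trans)
  have m: "0 < m"
    using maj0 pos_at_0 by (simp add: m_def majorizes_def)
  then have M: "0 < M" by (simp add: M_def)
  have lower: "\<exists>\<gamma> C. majorizes \<gamma> C b f \<and> \<gamma> * g 0 \<le> M \<and> \<gamma> / \<bar>det C\<bar> \<le> \<beta> / \<bar>det B\<bar>"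
    if maj: "majorizes \<beta> B b f" for \<beta> and B :: "real^'n^'n" and b
  proof (cases "\<beta> * g 0 \<le> M")
    case False
    then have "exp 1 ^ CARD('n) * m < \<beta> * g 0"
      by (simp add: M_def)
    then obtain \<gamma> C where "majorizes \<gamma> C b f" "\<gamma> * g 0 = M" "\<gamma> / \<bar>det C\<bar> < \<beta> / \<bar>det B\<bar>"
      using lower_height[OF maj fnn fm m] unfolding M_def by blast
    then show ?thesis
      by (intro exI[of _ \<gamma>] exI[of _ C]) auto
  qed (use maj in blast)
  obtain \<alpha>1 A1 where p1: "majorizes \<alpha>1 A1 a0 f" "\<alpha>1 * g 0 \<le> M"
    using lower[OF maj0] by blast
  define J where "J = \<alpha>1 / \<bar>det A1\<bar>"
  have J: "0 < J" "\<alpha>1 \<le> J * \<bar>det A1\<bar>"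
    using p1 by (auto simp: J_def majorizes_def)
  have shift: "f x \<le> \<beta> * g (norm (B *v x - B *v b))" if "majorizes \<beta> B b f" for \<beta> B b x
    using that by (simp add: majorizes_def matrix_vector_mult_diff_distrib)
  obtain \<alpha> A b where opt: "0 < \<alpha>" "det A \<noteq> 0" "\<And>x. f x \<le> \<alpha> * g (norm (A *v x - b))"
    "\<And>\<beta> B b'. \<beta> * g 0 \<le> M \<Longrightarrow> \<beta> \<le> J * \<bar>det B\<bar> \<Longrightarrow>
      (\<And>x. f x \<le> \<beta> * g (norm (B *v x - b'))) \<Longrightarrow> \<alpha> / \<bar>det A\<bar> \<le> \<beta> / \<bar>det B\<bar>"
    using least_volume_attained_below_height[OF zrc M J(1) p1(2) J(2) shift[OF p1(1)]] by blast
  obtain A' where A': "A ** A' = mat 1"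
    using opt(2) invertible_det_nz invertible_def by metis
  have "majorizes \<alpha> A (A' *v b) f"
    using opt(1-3) A' by (simp add: majorizes_def matrix_vector_mult_diff_distrib matrix_vector_mul_assoc)
  moreover have "\<alpha> / \<bar>det A\<bar> \<le> \<beta> / \<bar>det B\<bar>" if maj: "majorizes \<beta> B b f" for \<beta> B b
  proof (cases "\<beta> / \<bar>det B\<bar> \<le> J")
    case True
    obtain \<gamma> C where C: "majorizes \<gamma> C b f" "\<gamma> * g 0 \<le> M" "\<gamma> / \<bar>det C\<bar> \<le> \<beta> / \<bar>det B\<bar>"
      using lower[OF maj] by blast
    then have "\<gamma> / \<bar>det C\<bar> \<le> J"
      using True by simp
    then have "\<gamma> \<le> J * \<bar>det C\<bar>"
      using C(1) by (simp add: majorizes_def field_simps)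
    then show ?thesis
      using opt(4)[OF C(2) _ shift[OF C(1)]] C(3) by simp
  next
    case False
    then show ?thesis
      using opt(4)[OF p1(2) J(2) shift[OF p1(1)]] by (simp add: J_def)
  qed
  ultimately show ?thesis
    unfolding least_majorant_def by blast
qed

section \<open>Uniqueness\<close>

text \<open>The matrix of the midpoint is \<open>(D + 1)/2 Q A\<^sub>2\<close>, where \<open>|A\<^sub>1 A\<^sub>2\<^sup>-\<^sup>1 z| = |D Q z|\<close> is the singular value
  decomposition.\<close>

lemma midpoint_strictly_smaller:
  fixes f :: "real^'n \<Rightarrow> real"
  assumes 1: "majorizes \<alpha>1 A1 a1 f" and 2: "majorizes \<alpha>2 A2 a2 f" and f: "\<And>x. 0 \<le> f x"
    and neq: "norm (A1 *v y) \<noteq> norm (A2 *v y)"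
  obtains \<alpha> A a where "majorizes \<alpha> A a f"
    "(\<alpha> / \<bar>det A\<bar>)\<^sup>2 < (\<alpha>1 / \<bar>det A1\<bar>) * (\<alpha>2 / \<bar>det A2\<bar>)"
proof -
  have \<alpha>: "0 < \<alpha>1" "0 < \<alpha>2" and d: "det A1 \<noteq> 0" "det A2 \<noteq> 0"
    using 1 2 by (auto simp: majorizes_def)
  obtain A2' where A2': "A2 ** A2' = mat 1" "A2' ** A2 = mat 1"
    using d(2) invertible_det_nz invertible_def by metis
  define B where "B = A1 ** A2'"
  have BA2: "B *v (A2 *v x) = A1 *v x" for x
    by (simp add: B_def matrix_vector_mul_assoc matrix_mul_assoc[symmetric] A2')
  have detB: "det A1 = det B * det A2"
    using arg_cong[OF A2'(1), of det] by (simp add: B_def det_mul mult_ac)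
  then have "invertible B"
    using d by (auto simp: invertible_det_nz)
  then obtain Q s where Q: "orthogonal_matrix Q" and s: "\<And>i. 0 < s i"
    and BQ: "\<And>x. norm (B *v x) = norm (diag_matrix s *v (Q *v x))"
    using singular_value_decomposition by blast
  have detQ: "\<bar>det Q\<bar> = 1"
    using det_orthogonal_matrix[OF Q] by auto
  have dB: "\<bar>det B\<bar> = prod s UNIV"
  proof -
    have "det (diag_matrix s ** Q) \<noteq> 0"
      using detQ s by (auto simp: det_mul det_diag_matrix less_imp_neq[symmetric])
    then have "\<bar>det B\<bar> = \<bar>det (diag_matrix s ** Q)\<bar>"
      by (intro abs_det_eq_if_norm_eq) (simp_all add: invertible_det_nz BQ matrix_vector_mul_assoc)
    also have "\<dots> = prod s UNIV"
      using s by (simp add: det_mul det_diag_matrix detQ abs_mult abs_prod less_imp_le)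
    finally show ?thesis .
  qed
  \<comment> \<open>In the coordinates \<open>Q *v (A2 *v x)\<close> the two quadratic forms are
    diagonal, with scalings \<open>s i\<close> and 1; \<open>h i\<close> is their mean.\<close>
  define h where "h i = (s i + 1) / 2" for i
  define A where "A = diag_matrix h ** Q ** A2"
  have detA: "\<bar>det A\<bar> = prod h UNIV * \<bar>det A2\<bar>"
    using s by (simp add: A_def det_mul det_diag_matrix detQ abs_mult abs_prod h_def add_pos_pos less_imp_le)
  have h: "0 < h i" for i using s[of i] by (simp add: h_def)
  then have "0 < prod h UNIV" by (intro prod_pos) auto
  then have dA: "det A \<noteq> 0"
    using detA d(2) by (metis abs_eq_0 less_irrefl mult_eq_0_iff)
  have Av: "A *v x = (1 / 2) *\<^sub>R (diag_matrix s *v (Q *v (A2 *v x)) + Q *v (A2 *v x))" for x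
    by (simp add: A_def matrix_vector_mul_assoc[symmetric] diag_matrix_vector_mult vec_eq_iff h_def field_simps)
  obtain A' where A': "A ** A' = mat 1"
    using dA invertible_det_nz invertible_def by metis
  \<comment> \<open>With the centre determined by \<open>A *v a = w\<close>, the vector
    \<open>A *v (x - a)\<close> is the mean of two vectors whose norms are those of
    \<open>A1 *v (x - a1)\<close> and \<open>A2 *v (x - a2)\<close>.\<close>
  define w where "w = (1 / 2) *\<^sub>R (diag_matrix s *v (Q *v (A2 *v a1)) + Q *v (A2 *v a2))"
  define a where "a = A' *v w"
  have Aa: "A *v a = w"
    by (simp add: a_def matrix_vector_mul_assoc A')
  define \<alpha> where "\<alpha> = sqrt \<alpha>1 * sqrt \<alpha>2"
  have maj: "majorizes \<alpha> A a f"
    unfolding majorizes_def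
  proof (intro conjI allI dA)
    show "0 < \<alpha>" using \<alpha> by (simp add: \<alpha>_def)
    fix x
    define t1 where "t1 = norm (A1 *v (x - a1))"
    define t2 where "t2 = norm (A2 *v (x - a2))"
    have "A *v (x - a) = (1 / 2) *\<^sub>R (diag_matrix s *v (Q *v (A2 *v (x - a1))) + Q *v (A2 *v (x - a2)))"
    proof -
      have "A *v (x - a) = A *v x - w"
        by (simp add: matrix_vector_mult_diff_distrib Aa)
      then show ?thesis
        unfolding Av w_def by (simp add: matrix_vector_mult_diff_distrib algebra_simps)
    qed
    then have "norm (A *v (x - a)) \<le> (1 / 2) * (norm (diag_matrix s *v (Q *v (A2 *v (x - a1)))) + norm (Q *v (A2 *v (x - a2))))"
      using norm_triangle_ineq by (simp add: divide_right_mono)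
    also have "\<dots> = (1 - 1 / 2) * t1 + (1 / 2) * t2"
    proof -
      have "norm (diag_matrix s *v (Q *v (A2 *v (x - a1)))) = t1"
        by (simp only: t1_def BQ[symmetric] BA2)
      moreover have "norm (Q *v (A2 *v (x - a2))) = t2"
        by (simp only: t2_def norm_orthogonal_matrix_mult[OF Q])
      ultimately show ?thesis by simp
    qed
    finally have le: "norm (A *v (x - a)) \<le> (1 - 1 / 2) * t1 + (1 / 2) * t2" .
    have "f x = sqrt (f x) * sqrt (f x)"
      using f by simp
    also have "\<dots> \<le> sqrt (\<alpha>1 * g t1) * sqrt (\<alpha>2 * g t2)"
      using 1 2 f \<alpha> nonneg by (intro mult_mono) (auto simp: majorizes_def t1_def t2_def)
    also have "\<dots> = \<alpha> * (g t1 powr (1 - 1 / 2) * g t2 powr (1 / 2))"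
      using nonneg by (simp add: \<alpha>_def real_sqrt_mult powr_half_sqrt)
    also have "\<dots> \<le> \<alpha> * g ((1 - 1 / 2) * t1 + (1 / 2) * t2)"
      using \<alpha> by (intro mult_left_mono powr_le) (auto simp: \<alpha>_def)
    also have "\<dots> \<le> \<alpha> * g (norm (A *v (x - a)))"
      using \<alpha> le by (intro mult_left_mono antimono) (auto simp: \<alpha>_def)
    finally show "f x \<le> \<alpha> * g (norm (A *v (x - a)))" .
  qed
  have "\<exists>k. s k \<noteq> 1"
  proof (rule ccontr)
    assume "\<not> ?thesis"
    then have "diag_matrix s *v z = z" for z
      by (simp add: diag_matrix_vector_mult)
    then have "norm (A1 *v y) = norm (A2 *v y)"
      by (simp add: BQ norm_orthogonal_matrix_mult[OF Q] flip: BA2)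
    then show False using neq by simp
  qed
  then obtain k where k: "s k \<noteq> 1" by blast
  \<comment> \<open>The inequality of arithmetic and geometric means for \<open>s i\<close> and 1,
    with its defect; it is strict at the index \<open>k\<close>.\<close>
  have amgm: "(h i)\<^sup>2 - s i = ((s i - 1) / 2)\<^sup>2" for i
    by (simp add: h_def power2_eq_square field_simps)
  have "prod s UNIV < prod (\<lambda>i. (h i)\<^sup>2) UNIV"
  proof (rule prod_mono_strict[of k])
    have "0 < ((s k - 1) / 2)\<^sup>2" using k by simp
    then show "s k < (h k)\<^sup>2" using amgm[of k] by linarith
    show "0 \<le> s i \<and> s i \<le> (h i)\<^sup>2" for i
      using amgm[of i] s[of i] zero_le_power2[of "(s i - 1) / 2"] by linarith
    show "0 < (h i)\<^sup>2" for i
      using h[of i] by simp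
  qed auto
  then have lt: "prod s UNIV < (prod h UNIV)\<^sup>2"
    by (simp add: prod_power_distrib)
  have "(\<alpha> / \<bar>det A\<bar>)\<^sup>2 = \<alpha>1 * \<alpha>2 / ((prod h UNIV)\<^sup>2 * (det A2)\<^sup>2)"
    using \<alpha> by (simp add: \<alpha>_def detA power_divide power_mult_distrib)
  also have "\<dots> < \<alpha>1 * \<alpha>2 / (prod s UNIV * (det A2)\<^sup>2)"
  proof -
    have "0 < (det A2)\<^sup>2"
      using d(2) by simp
    moreover have "0 < (prod h UNIV)\<^sup>2"
      by (rule zero_less_power) fact
    moreover have "0 < prod s UNIV"
      by (intro prod_pos) (simp add: s)
    ultimately show ?thesis
      by (intro divide_strict_left_mono mult_strict_right_mono lt mult_pos_pos \<alpha>)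
  qed
  also have "\<dots> = (\<alpha>1 / \<bar>det A1\<bar>) * (\<alpha>2 / \<bar>det A2\<bar>)"
    by (simp add: detB abs_mult dB power2_eq_square)
  finally show ?thesis
    by (rule that[OF maj])
qed

text \<open>The room left between two translated majorants at distance \<open>2 v\<close>: dilating the argument by \<open>\<theta>\<close> and
  the height by \<open>c\<close> multiplies the integral by \<open>c / \<theta>\<^sup>d < 1\<close>.\<close>

definition shrinkable :: "nat \<Rightarrow> bool" where
  "shrinkable d \<longleftrightarrow> (\<forall>v>0. \<exists>c \<theta>. 0 < c \<and> 0 < \<theta> \<and> c < \<theta> ^ d \<and>
    (\<forall>t\<ge>0. g (sqrt (t\<^sup>2 + v\<^sup>2)) \<le> c * g (\<theta> * t)))"

text \<open>In the coordinate \<open>y = A *v (x - b)\<close> the centres lie at \<open>-w\<close>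
  and \<open>w\<close>. By the parallelogram law one of \<open>y + w\<close>, \<open>y - w\<close>
  has norm at least \<open>sqrt ((norm y)\<^sup>2 + (norm w)\<^sup>2)\<close>, and the corresponding
  majorant gives the better bound for \<open>f x\<close>.\<close>

lemma translates_strictly_smaller:
  fixes f :: "real^'n \<Rightarrow> real"
  assumes "shrinkable CARD('n)" and 1: "majorizes \<alpha> A a1 f"
    and 2: "\<And>x. f x \<le> \<alpha> * g (norm (A *v (x - a2)))" and neq: "a1 \<noteq> a2"
  obtains \<beta> B b where "majorizes \<beta> B b f" "\<beta> / \<bar>det B\<bar> < \<alpha> / \<bar>det A\<bar>"
proof -
  have \<alpha>: "0 < \<alpha>" and d: "det A \<noteq> 0" and f1: "\<And>x. f x \<le> \<alpha> * g (norm (A *v (x - a1)))"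
    using 1 by (auto simp: majorizes_def)
  define w where "w = A *v ((1 / 2) *\<^sub>R (a2 - a1))"
  define b where "b = (1 / 2) *\<^sub>R (a1 + a2)"
  have "w \<noteq> 0"
  proof
    assume "w = 0"
    then have "A *v a1 = A *v a2"
      by (simp add: w_def matrix_vector_mult_scaleR matrix_vector_mult_diff_distrib)
    then show False
      using d neq inj_matrix_vector_mult[of A] by (auto simp: invertible_det_nz inj_def)
  qed
  then obtain c \<theta> where c: "0 < c" "0 < \<theta>" "c < \<theta> ^ CARD('n)"
    and gc: "\<And>t. 0 \<le> t \<Longrightarrow> g (sqrt (t\<^sup>2 + (norm w)\<^sup>2)) \<le> c * g (\<theta> * t)"
    using assms(1) unfolding shrinkable_def by (metis zero_less_norm_iff)
  define B where "B = diag_matrix (\<lambda>_. \<theta>) ** A"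
  have detB: "det B = \<theta> ^ CARD('n) * det A"
    by (simp add: B_def det_diag_matrix_const_mult)
  have "f x \<le> \<alpha> * c * g (norm (B *v (x - b)))" for x
  proof -
    define y where "y = A *v (x - b)"
    have "x - a1 = (x - b) + (1 / 2) *\<^sub>R (a2 - a1)" "x - a2 = (x - b) - (1 / 2) *\<^sub>R (a2 - a1)"
      by (simp_all add: b_def vec_eq_iff field_simps)
    then have y1: "A *v (x - a1) = y + w" and y2: "A *v (x - a2) = y - w"
      unfolding y_def w_def by (metis matrix_vector_right_distrib, metis matrix_vector_mult_diff_distrib)
    let ?r = "sqrt ((norm y)\<^sup>2 + (norm w)\<^sup>2)"
    have sum: "(norm (y + w))\<^sup>2 + (norm (y - w))\<^sup>2 = 2 * ((norm y)\<^sup>2 + (norm w)\<^sup>2)"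
      by (simp add: power2_norm_eq_inner inner_add_left inner_add_right inner_diff_left inner_diff_right inner_commute)
    have "f x \<le> \<alpha> * g ?r"
    proof (cases "?r \<le> norm (y + w)")
      case True
      then have "g (norm (y + w)) \<le> g ?r" by (intro antimono) auto
      then show ?thesis
        using f1[of x] \<alpha> by (simp add: y1) (meson less_imp_le mult_left_mono order_trans)
    next
      case False
      then have "(norm (y + w))\<^sup>2 \<le> (norm y)\<^sup>2 + (norm w)\<^sup>2"
        using power_mono[of "norm (y + w)" ?r 2] by simp
      then have "(norm y)\<^sup>2 + (norm w)\<^sup>2 \<le> (norm (y - w))\<^sup>2"
        using sum by simp
      then have "?r \<le> norm (y - w)"
        by (simp add: real_le_lsqrt)
      then have "g (norm (y - w)) \<le> g ?r" by (intro antimono) auto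
      then show ?thesis
        using 2[of x] \<alpha> by (simp add: y2) (meson less_imp_le mult_left_mono order_trans)
    qed
    also have "\<dots> \<le> \<alpha> * (c * g (\<theta> * norm y))"
      using \<alpha> by (intro mult_left_mono gc) auto
    also have "\<theta> * norm y = norm (B *v (x - b))"
      using c(2) by (simp add: B_def y_def diag_matrix_const_mult)
    finally show ?thesis by (simp add: mult.assoc)
  qed
  then have "majorizes (\<alpha> * c) B b f"
    using \<alpha> c d by (simp add: majorizes_def detB)
  moreover have "\<alpha> * c / \<bar>det B\<bar> < \<alpha> / \<bar>det A\<bar>"
  proof -
    have "c / \<theta> ^ CARD('n) < 1"
      using c by simp
    moreover have "0 < \<alpha> / \<bar>det A\<bar>"
      using \<alpha> d by simp
    ultimately have "(\<alpha> / \<bar>det A\<bar>) * (c / \<theta> ^ CARD('n)) < \<alpha> / \<bar>det A\<bar>"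
      by (metis mult.right_neutral mult_strict_left_mono)
    then show ?thesis
      using c(2) by (simp add: detB abs_mult mult_ac)
  qed
  ultimately show ?thesis by (rule that)
qed

text \<open>Here \<open>c = 1\<close> works: on the bounded support the step from \<open>t\<close>
  to \<open>sqrt (t\<^sup>2 + v\<^sup>2)\<close> enlarges \<open>t\<close> at least by a fixed
  factor \<open>\<theta> > 1\<close>, and beyond it the left side vanishes. Positivity of
  \<open>d\<close> makes \<open>\<theta> ^ d\<close> exceed 1.\<close>

lemma shrinkable_if_bounded_support:
  assumes R: "\<And>t. R < t \<Longrightarrow> g t = 0" and "0 < d"
  shows "shrinkable d"
  unfolding shrinkable_def
proof (intro allI impI)
  fix v :: real assume v: "0 < v"
  \<comment> \<open>For \<open>0 \<le> t \<le> R\<close> the quotient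
    \<open>t / (\<bar>R\<bar> + 1)\<close> is at most 1, so
    \<open>\<theta>\<^sup>2 * t\<^sup>2 \<le> t\<^sup>2 + v\<^sup>2\<close>. The added 1 keeps the
    denominator positive.\<close>
  define \<theta> where "\<theta> = sqrt (1 + (v / (\<bar>R\<bar> + 1))\<^sup>2)"
  have \<theta>1: "1 < \<theta>"
    using v by (simp add: \<theta>_def)
  have "g (sqrt (t\<^sup>2 + v\<^sup>2)) \<le> 1 * g (\<theta> * t)" if t: "0 \<le> t" for t
  proof (cases "t \<le> R")
    case True
    have "\<theta> * t = sqrt (t\<^sup>2 + (v * (t / (\<bar>R\<bar> + 1)))\<^sup>2)"
    proof (rule real_sqrt_unique[symmetric])
      have "\<theta>\<^sup>2 = 1 + (v / (\<bar>R\<bar> + 1))\<^sup>2"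
        by (simp add: \<theta>_def)
      then show "(\<theta> * t)\<^sup>2 = t\<^sup>2 + (v * (t / (\<bar>R\<bar> + 1)))\<^sup>2"
        by (simp add: power_mult_distrib power_divide algebra_simps)
      show "0 \<le> \<theta> * t"
        using t \<theta>1 by simp
    qed
    also have "\<dots> \<le> sqrt (t\<^sup>2 + v\<^sup>2)"
    proof -
      have "t / (\<bar>R\<bar> + 1) \<le> 1" using True t by (simp add: field_simps)
      then have "v * (t / (\<bar>R\<bar> + 1)) \<le> v" using v by (intro mult_left_le) auto
      then show ?thesis
        using t v by (intro real_sqrt_le_mono add_left_mono power_mono) auto
    qed
    finally show ?thesis
      using antimono[of "\<theta> * t" "sqrt (t\<^sup>2 + v\<^sup>2)"] t \<theta>1 by simp
  next
    case False
    have "t \<le> sqrt (t\<^sup>2 + v\<^sup>2)"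
      using t by (intro real_le_rsqrt) simp
    then show ?thesis
      using R[of "sqrt (t\<^sup>2 + v\<^sup>2)"] False nonneg[of "\<theta> * t"] by linarith
  qed
  then show "\<exists>c \<theta>. 0 < c \<and> 0 < \<theta> \<and> c < \<theta> ^ d \<and> (\<forall>t\<ge>0. g (sqrt (t\<^sup>2 + v\<^sup>2)) \<le> c * g (\<theta> * t))"
    using \<theta>1 \<open>0 < d\<close> by (intro exI[of _ 1] exI[of _ \<theta>]) (auto intro: one_less_power)
qed

text \<open>The convex function \<open>h = - ln g\<close> has slope at least some
  \<open>\<sigma> > 0\<close> away from 0, so a gap between arguments becomes an exponential gain.
  For \<open>\<theta> = 1 - e\<close> this gap is at least \<open>v * sqrt e\<close>, uniformly in
  \<open>t\<close>, and for small \<open>e\<close> the gain outweighs the loss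
  \<open>(1 - e) ^ d\<close>.\<close>

lemma shrinkable_if_strictly_decreasing:
  assumes dec: "\<And>s t. 0 \<le> s \<Longrightarrow> s < t \<Longrightarrow> g t < g s"
  shows "shrinkable d"
  unfolding shrinkable_def
proof (intro allI impI)
  fix v :: real assume v: "0 < v"
  have gpos: "0 < g t" if "0 \<le> t" for t
    using dec[of t "t + 1"] nonneg[of "t + 1"] that by simp
  define h where "h t = - ln (g t)" for t
  have conv: "convex_on {0..} h"
  proof (rule convex_onI)
    fix u s t :: real assume u: "0 < u" "u < 1" and st: "s \<in> {0..}" "t \<in> {0..}"
    have "ln (g s powr (1 - u) * g t powr u) \<le> ln (g ((1 - u) * s + u * t))"
      using powr_le[OF u, of s t] st gpos[of s] gpos[of t] by (intro ln_mono) auto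
    moreover have "ln (g s powr (1 - u) * g t powr u) = (1 - u) * ln (g s) + u * ln (g t)"
      using st gpos[of s] gpos[of t] by (simp add: ln_mult_pos ln_powr)
    ultimately show "h ((1 - u) *\<^sub>R s + u *\<^sub>R t) \<le> (1 - u) * h s + u * h t"
      by (simp add: h_def)
  qed simp
  \<comment> \<open>The slope of the chord over \<open>[0, v / 2]\<close>; by convexity every chord
    further to the right is at least as steep.\<close>
  define \<sigma> where "\<sigma> = (h (v / 2) - h 0) / (v / 2)"
  have "0 < \<sigma>"
    using dec[of 0 "v / 2"] gpos v by (simp add: \<sigma>_def h_def)
  have slope: "\<sigma> * (t - s) \<le> h t - h s" if "v / 2 \<le> s" "s \<le> t" for s t
  proof (cases "s = t")
    case False
    then have st: "s < t" using that by simp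
    have "\<sigma> \<le> (h t - h 0) / (t - 0)"
    proof -
      have "(h (v / 2) - h 0) / (v / 2 - 0) \<le> (h t - h 0) / (t - 0)"
        using convex_on_slope_le[OF conv, of 0 t "v / 2"] v that st by (simp add: diff_divide_distrib)
      then show ?thesis by (simp add: \<sigma>_def)
    qed
    also have "\<dots> \<le> (h t - h s) / (t - s)"
    proof -
      have "(h 0 - h t) / (0 - t) \<le> (h s - h t) / (s - t)"
        using convex_on_slope_le[OF conv, of 0 t s] v that st by simp
      moreover have "(x - y) / (x' - y') = (y - x) / (y' - x')" for x y x' y' :: real
        by (metis minus_diff_eq minus_divide_divide)
      ultimately show ?thesis by metis
    qed
    finally show ?thesis
      using st by (simp add: field_simps)
  qed simp
  have dist: "g (sqrt (t\<^sup>2 + v\<^sup>2)) \<le> exp (- (\<sigma> / 2 * v * sqrt e)) * g ((1 - e) * t)"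
    if t: "0 \<le> t" and e: "0 < e" "e < 1" for e t
  proof -
    define U where "U = sqrt (t\<^sup>2 + v\<^sup>2)"
    define L where "L = (1 - e) * t"
    have L0: "0 \<le> L" using t e by (simp add: L_def)
    have vU: "v \<le> U"
      using v by (auto simp: U_def intro: real_le_rsqrt)
    \<comment> \<open>The gain is of order \<open>sqrt e\<close>, whereas the dilation by \<open>1 - e\<close> costs only a factor \<open>(1 - e)\<^sup>d\<close>.\<close>
    have gap: "v * sqrt e \<le> U - L"
    proof -
      \<comment> \<open>Cauchy-Schwarz for \<open>(1 - e, sqrt e)\<close> and \<open>(t, v)\<close>;
        the first vector has norm at most 1.\<close>
      have "(1 - e)\<^sup>2 + (sqrt e)\<^sup>2 \<le> 1"
        using e by (simp add: power2_eq_square algebra_simps)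
      moreover have "((1 - e) * t + sqrt e * v)\<^sup>2 \<le> ((1 - e)\<^sup>2 + (sqrt e)\<^sup>2) * (t\<^sup>2 + v\<^sup>2)"
        using zero_le_power2[of "(1 - e) * v - sqrt e * t"]
        by (simp add: power2_eq_square algebra_simps)
      ultimately have "((1 - e) * t + sqrt e * v)\<^sup>2 \<le> t\<^sup>2 + v\<^sup>2"
        by (smt (verit) mult_left_le_one_le mult_right_mono sum_power2_ge_zero mult_1)
      then have "(1 - e) * t + sqrt e * v \<le> U"
        unfolding U_def by (rule real_le_rsqrt)
      then show ?thesis by (simp add: L_def mult.commute)
    qed
    define m where "m = (U + L) / 2"
    have "0 \<le> v * sqrt e" using v e by simp
    then have LU: "L \<le> U" using gap by simp
    have "\<sigma> / 2 * v * sqrt e \<le> \<sigma> * (U - m)"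
      using gap \<open>0 < \<sigma>\<close> by (simp add: m_def field_simps) (smt (verit) mult_left_mono mult.commute mult.left_commute distrib_left)
    also have "\<dots> \<le> h U - h m"
      using vU L0 LU by (intro slope) (auto simp: m_def)
    finally have "\<sigma> / 2 * v * sqrt e \<le> h U - h m" .
    moreover have "h L \<le> h m"
      using antimono[of L m] gpos[of m] gpos[of L] L0 LU by (simp add: h_def m_def)
    ultimately have "\<sigma> / 2 * v * sqrt e \<le> h U - h L"
      by simp
    then have "ln (g U) \<le> - (\<sigma> / 2 * v * sqrt e) + ln (g L)"
      by (simp add: h_def)
    then have "exp (ln (g U)) \<le> exp (- (\<sigma> / 2 * v * sqrt e) + ln (g L))"
      by (simp only: exp_le_cancel_iff)
    moreover have "exp (ln (g U)) = g U" "exp (ln (g L)) = g L"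
      using gpos[of U] gpos[of L] L0 LU by (simp_all add: exp_ln)
    ultimately show ?thesis
      by (simp only: exp_add U_def L_def)
  qed
  \<comment> \<open>The second bound makes \<open>sqrt e\<close> smaller than
    \<open>\<sigma> * v / (4 * (real d + 1))\<close>, which gives
    \<open>2 * d * e < \<sigma> / 2 * v * sqrt e\<close>. The bound 1/2 gives
    \<open>ln (1 - e) \<ge> - 2 * e\<close>. The extra division by 2 keeps the inequality for
    \<open>sqrt e\<close> strict.\<close>
  define e where "e = min (1 / 2) ((\<sigma> * v / (4 * (real d + 1)))\<^sup>2 / 2)"
  have "0 < (\<sigma> * v / (4 * (real d + 1)))\<^sup>2"
    using v \<open>0 < \<sigma>\<close> by (intro zero_less_power divide_pos_pos mult_pos_pos) auto
  then have e: "0 < e" "e \<le> 1 / 2" "e < (\<sigma> * v / (4 * (real d + 1)))\<^sup>2"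
    unfolding e_def by linarith+
  have "2 * real d * e < \<sigma> / 2 * v * sqrt e"
  proof -
    have "sqrt e < \<sigma> * v / (4 * (real d + 1))"
      using e v \<open>0 < \<sigma>\<close> by (intro real_less_lsqrt) auto
    then have "2 * (2 * (real d + 1)) * sqrt e < \<sigma> * v"
      by (simp add: field_simps)
    then have "2 * real d * sqrt e < \<sigma> / 2 * v"
      using e(1) by (simp add: algebra_simps) (smt (verit) real_sqrt_gt_0_iff)
    then have "2 * real d * sqrt e * sqrt e < \<sigma> / 2 * v * sqrt e"
      by (rule mult_strict_right_mono) (simp add: e)
    moreover have "2 * real d * sqrt e * sqrt e = 2 * real d * e"
      using e(1) by simp
    ultimately show ?thesis by simp
  qed
  moreover have "- (2 * e) \<le> ln (1 - e)"
  proof -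
    have "e * e \<le> e * (1 / 2)"
      using e by (intro mult_left_mono) auto
    then show ?thesis
      using ln_one_minus_pos_lower_bound[of e] e(1,2) unfolding power2_eq_square by linarith
  qed
  then have "- (2 * real d * e) \<le> real d * ln (1 - e)"
    using mult_left_mono[of "- (2 * e)" "ln (1 - e)" "real d"] by (simp add: mult_ac)
  ultimately have "exp (- (\<sigma> / 2 * v * sqrt e)) < exp (real d * ln (1 - e))"
    by simp
  also have "\<dots> = (1 - e) ^ d"
    using e by (simp add: exp_of_nat_mult)
  finally show "\<exists>c \<theta>. 0 < c \<and> 0 < \<theta> \<and> c < \<theta> ^ d \<and> (\<forall>t\<ge>0. g (sqrt (t\<^sup>2 + v\<^sup>2)) \<le> c * g (\<theta> * t))"
    using dist[of _ e] e by (intro exI[of _ "exp (- (\<sigma> / 2 * v * sqrt e))"] exI[of _ "1 - e"]) auto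
qed

text \<open>The parameters are compared in turn: a midpoint below the common minimum is impossible,
  so the matrices induce the same norm; equal absolute determinants then force equal heights, and
  \<open>shrinkable\<close> excludes distinct centres. The matrices themselves may still differ by a
  rotation, hence the conclusion about functions.\<close>

theorem unique_least_majorant:
  fixes f :: "real^'n \<Rightarrow> real"
  assumes shr: "shrinkable CARD('n)" and f: "\<And>x. 0 \<le> f x"
    and least: "least_majorant \<alpha>1 A1 a1 f" "least_majorant \<alpha>2 A2 a2 f"
  shows "(\<lambda>x. \<alpha>1 * g (norm (A1 *v (x - a1)))) = (\<lambda>x. \<alpha>2 * g (norm (A2 *v (x - a2))))"
proof -
  have 1: "majorizes \<alpha>1 A1 a1 f" and 2: "majorizes \<alpha>2 A2 a2 f"
    using least unfolding least_majorant_def by blast+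
  have min1: "\<alpha>1 / \<bar>det A1\<bar> \<le> \<beta> / \<bar>det B\<bar>"
    and min2: "\<alpha>2 / \<bar>det A2\<bar> \<le> \<beta> / \<bar>det B\<bar>" if "majorizes \<beta> B b f" for \<beta> B b
    using least that unfolding least_majorant_def by blast+
  have J: "\<alpha>1 / \<bar>det A1\<bar> = \<alpha>2 / \<bar>det A2\<bar>"
    using min1[OF 2] min2[OF 1] by simp
  have d: "det A1 \<noteq> 0" "det A2 \<noteq> 0" and \<alpha>: "0 < \<alpha>1"
    using 1 2 by (auto simp: majorizes_def)
  have eq: "norm (A1 *v y) = norm (A2 *v y)" for y
  proof (rule ccontr)
    assume "\<not> ?thesis"
    then obtain \<alpha> A a where maj: "majorizes \<alpha> A a f"
      and lt: "(\<alpha> / \<bar>det A\<bar>)\<^sup>2 < (\<alpha>1 / \<bar>det A1\<bar>) * (\<alpha>2 / \<bar>det A2\<bar>)"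
      using midpoint_strictly_smaller[OF 1 2 f] by metis
    have "(\<alpha>1 / \<bar>det A1\<bar>)\<^sup>2 \<le> (\<alpha> / \<bar>det A\<bar>)\<^sup>2"
      using min1[OF maj] \<alpha> by (intro power_mono) auto
    then show False
      using lt J by (simp add: power2_eq_square)
  qed
  have "\<bar>det A1\<bar> = \<bar>det A2\<bar>"
    using d(2) eq by (intro abs_det_eq_if_norm_eq) (simp_all add: invertible_det_nz)
  then have \<alpha>12: "\<alpha>1 = \<alpha>2"
    using J d by simp
  have "a1 = a2"
  proof (rule ccontr)
    assume "a1 \<noteq> a2"
    moreover have "f x \<le> \<alpha>1 * g (norm (A1 *v (x - a2)))" for x
      using 2 by (simp add: majorizes_def \<alpha>12 eq)
    ultimately obtain \<beta> B b where "majorizes \<beta> B b f" "\<beta> / \<bar>det B\<bar> < \<alpha>1 / \<bar>det A1\<bar>"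
      using translates_strictly_smaller[OF shr 1] by metis
    then show False
      using min1[of \<beta> B b] by simp
  qed
  then show ?thesis
    by (simp add: \<alpha>12 eq)
qed

section \<open>The original problem in terms of least majorants\<close>

lemma is_min_above_iff:
  fixes f l :: "real^'n \<Rightarrow> real"
  assumes cls: "\<And>l :: real^'n \<Rightarrow> real. l \<in> ellipsoidal_class \<psi> \<longleftrightarrow>
    (\<exists>\<alpha> (A :: real^'n^'n) a. 0 < \<alpha> \<and> invertible A \<and> l = (\<lambda>x. \<alpha> * g (norm (A *v (x - a)))))"
  shows "is_min_above \<psi> f l \<longleftrightarrow>
    (\<exists>\<alpha> A a. l = (\<lambda>x. \<alpha> * g (norm (A *v (x - a)))) \<and> least_majorant \<alpha> A a f)"
proof -
  let ?l = "\<lambda>\<alpha> (A :: real^'n^'n) a x. \<alpha> * g (norm (A *v (x - a)))"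
  have feasible: "k \<in> ellipsoidal_class \<psi> \<and> f \<le> k \<longleftrightarrow> (\<exists>\<alpha> A a. k = ?l \<alpha> A a \<and> majorizes \<alpha> A a f)" for k
  proof
    assume "k \<in> ellipsoidal_class \<psi> \<and> f \<le> k"
    then obtain \<alpha> A a where "0 < \<alpha>" "invertible A" "k = ?l \<alpha> A a" "f \<le> k"
      unfolding cls by iprover
    then show "\<exists>\<alpha> A a. k = ?l \<alpha> A a \<and> majorizes \<alpha> A a f"
      by (intro exI[of _ \<alpha>] exI[of _ A] exI[of _ a])
        (simp add: majorizes_def invertible_det_nz le_fun_def)
  next
    assume "\<exists>\<alpha> A a. k = ?l \<alpha> A a \<and> majorizes \<alpha> A a f"
    then obtain \<alpha> A a where k: "k = ?l \<alpha> A a" and "majorizes \<alpha> A a f"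
      by iprover
    then have "0 < \<alpha>" "invertible A" "f \<le> k"
      by (simp_all add: majorizes_def invertible_det_nz le_fun_def)
    then show "k \<in> ellipsoidal_class \<psi> \<and> f \<le> k"
      using k unfolding cls by iprover
  qed
  \<comment> \<open>Both integrals are the quotients times the same positive \<open>mass\<close>, so
    the extended real comparison reduces to a real one.\<close>
  have int: "(\<integral>\<^sup>+x. ennreal (?l \<alpha> A a x) \<partial>lborel) < (\<integral>\<^sup>+x. ennreal (?l \<beta> B b x) \<partial>lborel)
      \<longleftrightarrow> \<alpha> / \<bar>det A\<bar> < \<beta> / \<bar>det B\<bar>"
    if "majorizes \<alpha> A a f" "majorizes \<beta> B b f" for \<alpha> \<beta> and A B :: "real^'n^'n" and a b
  proof -
    have "0 < \<alpha>" "invertible A" "0 < \<beta>" "invertible B"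
      using that by (auto simp: majorizes_def invertible_det_nz)
    then show ?thesis
      using mass_pos[where 'n='n]
      by (simp add: nn_integral_ellipsoidal ennreal_less_iff mult_less_cancel_right_pos
          del: times_divide_eq_left)
  qed
  show ?thesis
    unfolding is_min_above_def is_arg_min_def least_majorant_def feasible
    using int by (auto simp: not_less[symmetric] simp del: not_less) (metis+)
qed

end

theorem theorem1p1:
  fixes \<psi> :: "real \<Rightarrow> ereal" and f :: "real^'n \<Rightarrow> real"
  assumes "admissible \<psi>"
    and "(strict_mono_on {0..} \<psi> \<and> (\<forall>t\<ge>0. \<psi> t < \<infinity>)) \<or> bounded {t. 0 \<le> t \<and> \<psi> t < \<infinity>}"
    and "proper_log_concave f"
    and "\<exists>l\<in>ellipsoidal_class \<psi>. f \<le> l"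
  shows "(\<exists>!l. is_min_above \<psi> f l) \<and>
    (\<forall>l. is_min_above \<psi> f l \<longrightarrow>
      (SUP x. ereal (l x)) \<le> ereal (exp 1 ^ CARD('n)) * (SUP x. ereal (f x)))"
proof -
  define g where "g t = exp_neg (\<psi> \<bar>t\<bar>)" for t
  interpret radial_profile g
  proof
    show "g (- t) = g t" for t
      by (simp add: g_def)
    show "proper_log_concave g"
      using assms(1) unfolding g_def[abs_def] admissible_def by blast
  qed
  have cls: "l \<in> ellipsoidal_class \<psi> \<longleftrightarrow>
    (\<exists>\<alpha> (A :: real^'n^'n) a. 0 < \<alpha> \<and> invertible A \<and> l = (\<lambda>x. \<alpha> * g (norm (A *v (x - a)))))" for l :: "real^'n \<Rightarrow> real"
    unfolding ellipsoidal_class_def g_def mem_Collect_eq abs_norm_cancel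
    by (intro iff_exI) blast
  note min_iff = is_min_above_iff[of \<psi> f, OF cls]
  have lcf: "log_concave_fun f"
    using assms(3) by (simp add: proper_log_concave_def)
  note fnn = log_concave_fun_nonneg[OF lcf]
  \<comment> \<open>The two alternatives on \<open>\<psi>\<close> enter only here, as strict
    decrease or bounded support of \<open>g\<close>.\<close>
  have shr: "shrinkable CARD('n)"
    using assms(2)
  proof
    assume inc: "strict_mono_on {0..} \<psi> \<and> (\<forall>t\<ge>0. \<psi> t < \<infinity>)"
    show ?thesis
    proof (rule shrinkable_if_strictly_decreasing)
      fix s t :: real assume st: "0 \<le> s" "s < t"
      have lt: "\<psi> s < \<psi> t"
        using inc st by (auto intro: strict_mono_onD)
      have "\<psi> s \<noteq> -\<infinity>" "\<psi> t < \<infinity>"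
        using assms(1) inc st by (auto simp: admissible_def)
      then obtain x y where "\<psi> s = ereal x" "\<psi> t = ereal y"
        using lt by (cases "\<psi> s"; cases "\<psi> t") auto
      then show "g t < g s"
        using lt st by (simp add: g_def)
    qed
  next
    assume "bounded {t. 0 \<le> t \<and> \<psi> t < \<infinity>}"
    then obtain R where R: "\<And>t. 0 \<le> t \<Longrightarrow> \<psi> t < \<infinity> \<Longrightarrow> \<bar>t\<bar> \<le> R"
      by (auto simp: bounded_iff)
    show ?thesis
    \<comment> \<open>With the absolute value, \<open>t > \<bar>R\<bar>\<close> is positive as well,
      so \<open>g t\<close> is \<open>exp_neg (\<psi> t)\<close>.\<close>
    proof (rule shrinkable_if_bounded_support[of "\<bar>R\<bar>"])
      fix t assume "\<bar>R\<bar> < t"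
      then have "\<not> \<psi> t < \<infinity>"
        using R[of t] by linarith
      then show "g t = 0"
        using \<open>\<bar>R\<bar> < t\<close> by (simp add: g_def)
    qed simp
  qed
  obtain \<alpha>0 A0 a0 where "majorizes \<alpha>0 A0 a0 f"
    using assms(4) by (auto simp: cls majorizes_def invertible_det_nz le_fun_def)
  then obtain \<alpha> A a where opt: "least_majorant \<alpha> A a f"
    using exists_least_majorant[OF assms(3)] by blast
  have unique: "(\<lambda>x. \<alpha> * g (norm (A *v (x - a)))) = (\<lambda>x. \<beta> * g (norm (B *v (x - b))))"
    if "least_majorant \<beta> B b f" for \<beta> B b
    by (rule unique_least_majorant[OF shr fnn opt that])
  have "\<exists>!l. is_min_above \<psi> f l"
  proof
    show "is_min_above \<psi> f (\<lambda>x. \<alpha> * g (norm (A *v (x - a))))"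
      using opt unfolding min_iff by blast
    show "l = (\<lambda>x. \<alpha> * g (norm (A *v (x - a))))" if l: "is_min_above \<psi> f l" for l
    proof -
      obtain \<beta> B b where "l = (\<lambda>x. \<beta> * g (norm (B *v (x - b))))" "least_majorant \<beta> B b f"
        using l unfolding min_iff by blast
      then show ?thesis
        using unique by simp
    qed
  qed
  moreover have "(SUP x. ereal (l x)) \<le> ereal (exp 1 ^ CARD('n)) * (SUP x. ereal (f x))"
    if min: "is_min_above \<psi> f l" for l
  proof -
    obtain \<beta> B b where l: "l = (\<lambda>x. \<beta> * g (norm (B *v (x - b))))" and lm: "least_majorant \<beta> B b f"
      using min unfolding min_iff by blast
    have \<beta>: "0 < \<beta>" and fl: "\<And>x. f x \<le> l x" and maj: "majorizes \<beta> B b f"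
      using lm by (auto simp: least_majorant_def majorizes_def l)
    have lg: "l x \<le> \<beta> * g 0" for x
      using \<beta> le_at_0 by (simp add: l)
    obtain z r c where "0 < r" "0 < c" "\<And>y. y \<in> ball z r \<Longrightarrow> c \<le> f y"
      by (rule log_concave_superlevel_ball[OF assms(3)]) iprover
    then have fz: "0 < f z" by (meson centre_in_ball less_le_trans)
    have up: "ereal (f x) \<le> (SUP x. ereal (f x))" for x
      by (intro SUP_upper) simp
    have "(SUP x. ereal (f x)) \<le> ereal (\<beta> * g 0)"
      by (intro SUP_least) (simp add: order_trans[OF fl lg])
    \<comment> \<open>The supremum is finite, lying between \<open>f z\<close> and the height of the
      majorant.\<close>
    then obtain m where m: "(SUP x. ereal (f x)) = ereal m"
      using up[of z] by (cases "SUP x. ereal (f x)") auto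
    have fm: "f x \<le> m" for x
      using up[of x] by (simp add: m)
    then have "0 < m"
      using fz less_le_trans by blast
    \<comment> \<open>With \<open>m\<close> the exact supremum of \<open>f\<close>, a greater height
      would let \<open>lower_height\<close> produce a majorant below the minimum.\<close>
    have "\<beta> * g 0 \<le> exp 1 ^ CARD('n) * m"
    proof (rule ccontr)
      assume "\<not> ?thesis"
      then obtain \<gamma> C where "majorizes \<gamma> C b f" "\<gamma> / \<bar>det C\<bar> < \<beta> / \<bar>det B\<bar>"
        using lower_height[OF maj fnn fm \<open>0 < m\<close>] by (metis not_le)
      then show False
        using lm unfolding least_majorant_def by (meson not_le)
    qed
    then have "ereal (l x) \<le> ereal (exp 1 ^ CARD('n)) * ereal m" for x
      using lg[of x] by simp
    then show ?thesis
      unfolding m by (intro SUP_least)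
  qed
  ultimately show ?thesis by blast
qed

end
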